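(* (1) The tie set statistic $\mathrm{Tie}$ is shuffle-compatible on words. (2) The tie set shuffle algebra $\mathcal{A}^{W}_{\mathrm{Tie}}$ is isomorphic (as a $\mathbb{Q}$-algebra) to the algebra $\mathrm{QSym}$ of quasisymmetric functions.
   Context: All algebras are over $\mathbb{Q}$; $\mathrm{QSym}$ is the algebra of quasisymmetric functions over $\mathbb{Q}$. A word of length $n\ge0$ is a sequence $\alpha=(\alpha_1,\dots,\alpha_n)$ of positive integers; $|\alpha|=n$; $W$ is the set of all words. If the distinct letters of $\alpha$ are $a_1<\dots<a_k$, then $\mathrm{pack}(\alpha)$ is obtained by replacing each $a_i$ by $i$. Two words are disjoint if they have no common letter. $\mathrm{Sh}(\alpha,\beta)$ is the multiset of all $\binom{|\alpha|+|\beta|}{|\alpha|}$ interleavings (shuffles) of $\alpha$ and $\beta$. The tie set is $\mathrm{Tie}(\alpha)=\{i\in[n-1]:\alpha_i=\alpha_{i+1}\}$. A statistic $\mathrm{st}$ (function on $W$) is shuffle-compatible on words if (i) for all disjoint words $\alpha,\beta$ the multiset $\{\{\mathrm{st}(\gamma):\gamma\in \mathrm{Sh}(\alpha,\beta)\}\}$ is determined by $|\alpha|,|\beta|,\mathrm{st}(\alpha),\mathrm{st}(\beta)$; and (ii) $\mathrm{pack}(\alpha)=\mathrm{pack}(\beta)$ implies $\mathrm{st}(\alpha)=\mathrm{st}(\beta)$. Let $[\alpha]^W_{\mathrm{st}}=\{\beta\in W:\mathrm{st}(\beta)=\mathrm{st}(\alpha),|\beta|=|\alpha|\}$. $\mathcal{A}^W_{\mathrm{st}}$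 is the algebra with basis these classes and product $[\alpha]^W_{\mathrm{st}}[\beta]^W_{\mathrm{st}}=\sum_{\gamma\in \mathrm{Sh}(\alpha,\beta)}[\gamma]^W_{\mathrm{st}}$, for disjoint representatives $\alpha,\beta$. *)

theory Defs
  imports "HOL-Algebra.Algebraic_Closure_Type"
    "HOL-Library.Multiset" "HOL-Library.Poly_Mapping"
begin

section \<open>Words and shuffles\<close>

definition words :: "nat list set" where
  "words = {\<alpha>. \<forall>a\<in>set \<alpha>. 0 < a}"

definition disjoint_words :: "nat list \<Rightarrow> nat list \<Rightarrow> bool" where
  "disjoint_words \<alpha> \<beta> \<longleftrightarrow> set \<alpha> \<inter> set \<beta> = {}"

text \<open>The rank of a letter among the distinct letters of the word, counted from 1.\<close>

definition pack :: "nat list \<Rightarrow> nat list" where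
  "pack \<alpha> = map (\<lambda>a. card {b \<in> set \<alpha>. b \<le> a}) \<alpha>"

text \<open>The library function \<open>shuffles\<close> yields the set of interleavings; here they are
  counted with multiplicity.\<close>

fun Sh :: "'a list \<Rightarrow> 'a list \<Rightarrow> 'a list multiset" where
  "Sh [] \<beta> = {#\<beta>#}"
| "Sh \<alpha> [] = {#\<alpha>#}"
| "Sh (a # \<alpha>) (b # \<beta>) =
     image_mset ((#) a) (Sh \<alpha> (b # \<beta>)) + image_mset ((#) b) (Sh (a # \<alpha>) \<beta>)"

lemma set_mset_Sh: "set_mset (Sh \<alpha> \<beta>) = shuffles \<alpha> \<beta>"
  by (induction \<alpha> \<beta> rule: Sh.induct) auto

lemma size_Sh: "size (Sh \<alpha> \<beta>) = (length \<alpha> + length \<beta>) choose length \<alpha>"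
  by (induction \<alpha> \<beta> rule: Sh.induct) auto

lemma Sh_disjoint: "disjoint_words \<alpha> \<beta> \<Longrightarrow> Sh \<alpha> \<beta> = mset_set (shuffles \<alpha> \<beta>)"
  unfolding disjoint_words_def
proof (induction \<alpha> \<beta> rule: Sh.induct)
  case (3 a \<alpha> b \<beta>)
  have "(#) a ` shuffles \<alpha> (b # \<beta>) \<inter> (#) b ` shuffles (a # \<alpha>) \<beta> = {}"
    using 3(3) by auto
  then show ?case
    using 3 by (simp add: mset_set_Union image_mset_mset_set)
qed auto

section \<open>Statistics\<close>

definition Tie :: "nat list \<Rightarrow> nat set" where
  "Tie \<alpha> = {i \<in> {1..length \<alpha> - 1}. \<alpha> ! (i - 1) = \<alpha> ! i}"

definition shuffle_compatible :: "(nat list \<Rightarrow> 's) \<Rightarrow> bool" where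
  "shuffle_compatible st \<longleftrightarrow>
     (\<forall>\<alpha>\<in>words. \<forall>\<beta>\<in>words. \<forall>\<alpha>'\<in>words. \<forall>\<beta>'\<in>words.
        disjoint_words \<alpha> \<beta> \<and> disjoint_words \<alpha>' \<beta>' \<and>
        length \<alpha> = length \<alpha>' \<and> length \<beta> = length \<beta>' \<and> st \<alpha> = st \<alpha>' \<and> st \<beta> = st \<beta>' \<longrightarrow>
        image_mset st (Sh \<alpha> \<beta>) = image_mset st (Sh \<alpha>' \<beta>')) \<and>
     (\<forall>\<alpha>\<in>words. \<forall>\<beta>\<in>words. pack \<alpha> = pack \<beta> \<longrightarrow> st \<alpha> = st \<beta>)"

definition word_class :: "(nat list \<Rightarrow> 's) \<Rightarrow> nat list \<Rightarrow> nat list set" where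
  "word_class st \<alpha> = {\<beta> \<in> words. st \<beta> = st \<alpha> \<and> length \<beta> = length \<alpha>}"

section \<open>The shuffle algebra of a statistic\<close>

definition basis_vec :: "'a \<Rightarrow> 'a \<Rightarrow>\<^sub>0 rat" where
  "basis_vec C = Poly_Mapping.single C 1"

definition scale :: "rat \<Rightarrow> ('a \<Rightarrow>\<^sub>0 rat) \<Rightarrow> ('a \<Rightarrow>\<^sub>0 rat)" where
  "scale c f = Poly_Mapping.map ((*) c) f"

text \<open>Product of two basis elements, computed from some pair of disjoint representatives. For a
  shuffle-compatible statistic the choice is irrelevant, see \<open>class_product_word_class\<close> below.\<close>

definition class_product ::
    "(nat list \<Rightarrow> 's) \<Rightarrow> nat list set \<Rightarrow> nat list set \<Rightarrow> (nat list set \<Rightarrow>\<^sub>0 rat)" where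
  "class_product st C D =
     (let (\<alpha>, \<beta>) = (SOME (\<alpha>, \<beta>). \<alpha> \<in> C \<and> \<beta> \<in> D \<and> disjoint_words \<alpha> \<beta>)
      in \<Sum>\<gamma>\<in>#Sh \<alpha> \<beta>. basis_vec (word_class st \<gamma>))"

text \<open>The underlying vector space consists of the finitely supported rational-valued functions on
  the set of classes; the product is the bilinear extension of \<^const>\<open>class_product\<close>.\<close>

definition shuffle_algebra :: "(nat list \<Rightarrow> 's) \<Rightarrow> (rat, nat list set \<Rightarrow>\<^sub>0 rat) module" where
  "shuffle_algebra st =
     \<lparr>carrier = {f. Poly_Mapping.keys f \<subseteq> word_class st ` words},
      monoid.mult = (\<lambda>f g. \<Sum>C\<in>Poly_Mapping.keys f. \<Sum>D\<in>Poly_Mapping.keys g.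
                scale (Poly_Mapping.lookup f C * Poly_Mapping.lookup g D) (class_product st C D)),
      one = basis_vec (word_class st []),
      ring.zero = 0,
      ring.add = (+),
      module.smult = scale\<rparr>"

lemma class_product_word_class:
  assumes st: "shuffle_compatible st"
    and \<alpha>\<beta>: "\<alpha> \<in> words" "\<beta> \<in> words" "disjoint_words \<alpha> \<beta>"
  shows "class_product st (word_class st \<alpha>) (word_class st \<beta>) =
           (\<Sum>\<gamma>\<in>#Sh \<alpha> \<beta>. basis_vec (word_class st \<gamma>))"
proof -
  define Q where "Q = (\<lambda>(\<alpha>', \<beta>').
    \<alpha>' \<in> word_class st \<alpha> \<and> \<beta>' \<in> word_class st \<beta> \<and> disjoint_words \<alpha>' \<beta>')"
  obtain \<alpha>' \<beta>' where some: "(SOME p. Q p) = (\<alpha>', \<beta>')"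
    by (cases "SOME p. Q p")
  have "Q (\<alpha>, \<beta>)"
    using \<alpha>\<beta> by (simp add: Q_def word_class_def)
  then have "Q (\<alpha>', \<beta>')"
    using some by (metis someI)
  then have Q: "\<alpha>' \<in> words" "\<beta>' \<in> words" "disjoint_words \<alpha>' \<beta>'"
      "length \<alpha>' = length \<alpha>" "length \<beta>' = length \<beta>" "st \<alpha>' = st \<alpha>" "st \<beta>' = st \<beta>"
    by (auto simp: Q_def word_class_def)
  define cls where "cls = (\<lambda>s. {\<delta> \<in> words. st \<delta> = s \<and> length \<delta> = length \<alpha> + length \<beta>})"
  have cls: "image_mset (\<lambda>\<gamma>. basis_vec (word_class st \<gamma>)) (Sh \<mu> \<nu>) =
      image_mset (\<lambda>s. basis_vec (cls s)) (image_mset st (Sh \<mu> \<nu>))"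
    if "length \<mu> = length \<alpha>" "length \<nu> = length \<beta>" for \<mu> \<nu>
    unfolding multiset.map_comp using that
    by (intro image_mset_cong)
       (auto simp: set_mset_Sh length_shuffles cls_def word_class_def)
  have "image_mset st (Sh \<alpha>' \<beta>') = image_mset st (Sh \<alpha> \<beta>)"
    using st Q \<alpha>\<beta> unfolding shuffle_compatible_def by blast
  then have "image_mset (\<lambda>\<gamma>. basis_vec (word_class st \<gamma>)) (Sh \<alpha>' \<beta>') =
      image_mset (\<lambda>\<gamma>. basis_vec (word_class st \<gamma>)) (Sh \<alpha> \<beta>)"
    using Q by (simp only: cls)
  then show ?thesis
    using some unfolding class_product_def Q_def by simp
qed

lemma shuffle_algebra_mult_basis:
  assumes "shuffle_compatible st" "\<alpha> \<in> words" "\<beta> \<in> words" "disjoint_words \<alpha> \<beta>"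
  shows "basis_vec (word_class st \<alpha>) \<otimes>\<^bsub>shuffle_algebra st\<^esub> basis_vec (word_class st \<beta>) =
           (\<Sum>\<gamma>\<in>#Sh \<alpha> \<beta>. basis_vec (word_class st \<gamma>))"
proof -
  have "scale 1 f = f" for f :: "nat list set \<Rightarrow>\<^sub>0 rat"
    by (rule poly_mapping_eqI) (simp add: scale_def Poly_Mapping.map.rep_eq when_def)
  then show ?thesis
    using class_product_word_class[OF assms]
    by (simp add: shuffle_algebra_def basis_vec_def)
qed

section \<open>Quasisymmetric functions\<close>

text \<open>The variables $x_i$ are indexed by all of \<^typ>\<open>nat\<close>, only their order being relevant. A
  monomial is a finitely supported exponent vector, and a power series is the function sending
  each monomial to its coefficient.\<close>

type_synonym power_series = "(nat \<Rightarrow>\<^sub>0 nat) \<Rightarrow> rat"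

definition monomial_degree :: "(nat \<Rightarrow>\<^sub>0 nat) \<Rightarrow> nat" where
  "monomial_degree m = (\<Sum>i\<in>Poly_Mapping.keys m. Poly_Mapping.lookup m i)"

text \<open>The monomial $x_{i_1}^{e_1} \cdots x_{i_k}^{e_k}$.\<close>

definition monomial_of :: "nat list \<Rightarrow> nat list \<Rightarrow> (nat \<Rightarrow>\<^sub>0 nat)" where
  "monomial_of is es = sum_list (map2 Poly_Mapping.single is es)"

definition quasisymmetric :: "power_series \<Rightarrow> bool" where
  "quasisymmetric f \<longleftrightarrow>
     (\<exists>d. \<forall>m. f m \<noteq> 0 \<longrightarrow> monomial_degree m \<le> d) \<and>
     (\<forall>es is js. (\<forall>e\<in>set es. 0 < e) \<and>
        length is = length es \<and> length js = length es \<and>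
        sorted_wrt (<) is \<and> sorted_wrt (<) js \<longrightarrow>
        f (monomial_of is es) = f (monomial_of js es))"

definition QSym :: "(rat, power_series) module" where
  "QSym =
     \<lparr>carrier = {f. quasisymmetric f},
      monoid.mult = (\<lambda>f g m. \<Sum>(p, q) | p + q = m. f p * g q),
      one = (\<lambda>m. if m = 0 then 1 else 0),
      ring.zero = (\<lambda>m. 0),
      ring.add = (\<lambda>f g m. f m + g m),
      module.smult = (\<lambda>c f m. c * f m)\<rparr>"

lemma finite_monomial_decompositions:
  fixes m :: "nat \<Rightarrow>\<^sub>0 nat"
  shows "finite {(p, q). p + q = m}"
proof -
  let ?F = "{h. \<forall>i. (i \<in> Poly_Mapping.keys m \<longrightarrow>
                  h i \<in> {..Max (Poly_Mapping.lookup m ` Poly_Mapping.keys m)}) \<and>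
                (i \<notin> Poly_Mapping.keys m \<longrightarrow> h i = (0::nat))}"
  have le: "Poly_Mapping.lookup p i \<le> Max (Poly_Mapping.lookup m ` Poly_Mapping.keys m)"
    if "p + q = m" "i \<in> Poly_Mapping.keys m" for p q i
  proof -
    have "Poly_Mapping.lookup p i \<le> Poly_Mapping.lookup m i"
      using that by (auto simp: lookup_add)
    also have "\<dots> \<le> Max (Poly_Mapping.lookup m ` Poly_Mapping.keys m)"
      using that by simp
    finally show ?thesis .
  qed
  have "Poly_Mapping.lookup p \<in> ?F" if "p + q = m" for p q
    using le[OF that] that by (auto simp: in_keys_iff lookup_add)
  moreover have "finite ?F"
    by (intro finite_set_of_finite_funs) auto
  ultimately have "finite (Poly_Mapping.lookup ` fst ` {(p, q). p + q = m})"
    by (elim finite_subset[rotated]) auto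
  moreover have "inj_on (Poly_Mapping.lookup \<circ> fst) {(p, q). p + q = m}"
    by (auto simp: inj_on_def lookup_inject)
  ultimately show ?thesis
    using finite_imageD by (metis image_comp)
qed

section \<open>Isomorphism of algebras\<close>

definition isomorphic_algebras ::
    "('r, 'x) ring_scheme \<Rightarrow> ('r, 'a, 'y) module_scheme \<Rightarrow> ('r, 'b, 'z) module_scheme \<Rightarrow> bool" where
  "isomorphic_algebras R A B \<longleftrightarrow>
     algebra R A \<and> algebra R B \<and>
     (\<exists>h \<in> ring_iso A B. \<forall>c\<in>carrier R. \<forall>x\<in>carrier A.
        h (c \<odot>\<^bsub>A\<^esub> x) = c \<odot>\<^bsub>B\<^esub> h x)"

abbreviation rat_field :: "rat ring" where
  "rat_field \<equiv> ring_of_type_algebra"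

end

theory Submission
  imports Defs
begin

text \<open>Let T denote a gap between two equal adjacent letters of a word and N a gap between two
  distinct ones, and put D = T - N formally. In a shuffle with a disjoint word, a gap that receives
  new letters becomes N gaps only, so a broken D gap contributes zero and a block of letters held
  together by D gaps is shuffled as a single letter. Expanding T = N + D therefore identifies the
  tie set algebra with the shuffle algebra on compositions, which over the rationals is isomorphic
  to the quasi-shuffle algebra of monomial quasisymmetric functions by Hoffman's exponential. Both
  changes of basis are unitriangular with respect to the number of parts, the first towards finer
  and the second towards coarser compositions.\<close>

section \<open>Ties and runs\<close>

text \<open>The two triangularities point in opposite directions, so their composite is not
  triangular in the number of parts. Injectivity therefore picks an extremal term twice, once with
  the fewest runs and once with the most parts, and surjectivity inverts one change of basis after
  the other. The factorials come from counting: k and l letters have (k + l)! / (k! l!) shuffles,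
  and dividing by (k + l)! leaves 1 / (k! l!). The weights thus multiply when segments belonging to
  the same variable are shuffled; this is where rational coefficients enter. The subtraction in D is
  never carried out: only ties are expanded, all multiplicities are natural numbers, and the
  intermediate algebra on compositions is not constructed. The product of
  \<open>shuffle_algebra Tie\<close> rests on chosen representatives, so its algebra laws are pulled
  back from power series along the bijection.\<close>

lemma Tie_Nil [simp]: "Tie [] = {}"
  by (simp add: Tie_def)

lemma Tie_singleton [simp]: "Tie [a] = {}"
  by (simp add: Tie_def)

lemma Tie_Cons_Cons [simp]:
  "Tie (a # b # w) = (if a = b then {1} else {}) \<union> Suc ` Tie (b # w)"
proof (rule Set.set_eqI)
  fix i
  show "i \<in> Tie (a # b # w) \<longleftrightarrow> i \<in> (if a = b then {1} else {}) \<union> Suc ` Tie (b # w)"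
  proof (cases i)
    case (Suc j)
    then show ?thesis
      by (cases j) (auto simp: Tie_def image_iff)
  qed (simp add: Tie_def)
qed

lemma zero_notin_Tie [simp]: "0 \<notin> Tie \<alpha>"
  by (simp add: Tie_def)

text \<open>Tie positions start at 1, so a shifted tie set never contains 1, and membership of 1
  records the first gap alone.\<close>

lemma Tie_Cons_Cons_eq_iff:
  "Tie (a # b # v) = Tie (c # d # w) \<longleftrightarrow> (a = b \<longleftrightarrow> c = d) \<and> Tie (b # v) = Tie (d # w)"
proof -
  have "Suc 0 \<notin> Suc ` Tie x" for x
    by auto
  moreover have "insert (Suc 0) (Suc ` Tie x) = insert (Suc 0) (Suc ` Tie y) \<longleftrightarrow> Tie x = Tie y" for x y
    using calculation by (metis inj_Suc inj_image_eq_iff insert_ident)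
  ultimately show ?thesis
    by (auto simp: inj_image_eq_iff) (metis insertI1)+
qed

section \<open>Shuffle compatibility of the tie set\<close>

lemma Sh_Nil_right [simp]: "Sh \<alpha> [] = {#\<alpha>#}"
  by (cases \<alpha>) auto

lemma Sh_commute: "Sh \<alpha> \<beta> = Sh \<beta> \<alpha>"
  by (induction \<alpha> \<beta> rule: Sh.induct) (auto simp: add.commute)

text \<open>The letter \<open>x\<close> is the one emitted last, and \<open>\<alpha>\<close> is the
  rest of its word. A next letter from \<open>\<beta>\<close> makes no tie, by disjointness; one
  from \<open>\<alpha>\<close> makes a tie exactly as in \<open>x # \<alpha>\<close>. Either way the
  same situation recurs. The two words may exchange roles, hence the induction on the total
  length.\<close>

lemma image_Tie_Cons_Sh:
  assumes "length \<alpha> = length \<alpha>'" "length \<beta> = length \<beta>'"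
    "set (x # \<alpha>) \<inter> set \<beta> = {}" "set (x' # \<alpha>') \<inter> set \<beta>' = {}"
    "Tie (x # \<alpha>) = Tie (x' # \<alpha>')" "Tie \<beta> = Tie \<beta>'"
  shows "image_mset (\<lambda>\<gamma>. Tie (x # \<gamma>)) (Sh \<alpha> \<beta>) = image_mset (\<lambda>\<gamma>. Tie (x' # \<gamma>)) (Sh \<alpha>' \<beta>')"
  using assms
proof (induction "length \<alpha> + length \<beta>" arbitrary: x \<alpha> \<beta> x' \<alpha>' \<beta>' rule: less_induct)
  case less
  show ?case
  proof (cases "\<alpha> = [] \<or> \<beta> = []")
    case True
    then show ?thesis
      using less.prems by (cases \<beta>; cases \<beta>') auto
  next
    case False
    then obtain a \<gamma> b \<delta> where \<alpha>: "\<alpha> = a # \<gamma>" and \<beta>: "\<beta> = b # \<delta>"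
      by (meson neq_Nil_conv)
    obtain a' \<gamma>' b' \<delta>' where \<alpha>': "\<alpha>' = a' # \<gamma>'" and \<beta>': "\<beta>' = b' # \<delta>'"
      using less.prems(1,2) \<alpha> \<beta> by (metis length_Suc_conv)
    have ne: "x \<noteq> b" "x' \<noteq> b'" and eq: "x = a \<longleftrightarrow> x' = a'" and T: "Tie \<alpha> = Tie \<alpha>'"
      using less.prems unfolding \<alpha> \<beta> \<alpha>' \<beta>' Tie_Cons_Cons_eq_iff by auto
    have 1: "image_mset (\<lambda>\<gamma>. Tie (a # \<gamma>)) (Sh \<gamma> \<beta>) = image_mset (\<lambda>\<gamma>. Tie (a' # \<gamma>)) (Sh \<gamma>' \<beta>')"
      using less.prems T by (intro less.hyps) (auto simp: \<alpha> \<alpha>')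
    \<comment> \<open>Here the emitted letter comes from \<open>\<beta>\<close>, so the rest of
      \<open>\<beta>\<close> moves to the first place.\<close>
    have 2: "image_mset (\<lambda>\<gamma>. Tie (b # \<gamma>)) (Sh \<delta> \<alpha>) = image_mset (\<lambda>\<gamma>. Tie (b' # \<gamma>)) (Sh \<delta>' \<alpha>')"
      using less.prems T by (intro less.hyps) (auto simp: \<beta> \<beta>')
    define f where "f = (\<lambda>P T. (if P then {1} else {}) \<union> Suc ` T)"
    have split: "image_mset (\<lambda>\<gamma>. Tie (x # \<gamma>)) (Sh (a # \<gamma>) (b # \<delta>)) =
        image_mset (f (x = a)) (image_mset (\<lambda>\<gamma>. Tie (a # \<gamma>)) (Sh \<gamma> (b # \<delta>))) +
        image_mset (f (x = b)) (image_mset (\<lambda>\<gamma>. Tie (b # \<gamma>)) (Sh \<delta> (a # \<gamma>)))"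
      for x a b :: nat and \<gamma> \<delta>
      by (simp add: f_def multiset.map_comp comp_def Sh_commute[of \<delta>])
    show ?thesis
      unfolding \<alpha> \<beta> \<alpha>' \<beta>' split using 1 2 ne eq unfolding \<alpha> \<beta> \<alpha>' \<beta>' by simp
  qed
qed

text \<open>The rank is strictly increasing on the letters of a word, so packing preserves and
  reflects equality of letters.\<close>

lemma pack_eq_imp_Tie_eq:
  assumes "pack \<alpha> = pack \<beta>"
  shows "Tie \<alpha> = Tie \<beta>"
proof -
  define r where "r = (\<lambda>\<alpha>::nat list. \<lambda>a. card {b \<in> set \<alpha>. b \<le> a})"
  have "r \<gamma> a = r \<gamma> b \<longleftrightarrow> a = b" if "a \<in> set \<gamma>" "b \<in> set \<gamma>" for \<gamma> a b
  proof -
    have "r \<gamma> c < r \<gamma> d" if "d \<in> set \<gamma>" "c < d" for c d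
    proof -
      have "d \<in> {b \<in> set \<gamma>. b \<le> d} - {b \<in> set \<gamma>. b \<le> c}"
        using that by simp
      then show ?thesis
        unfolding r_def using that by (intro psubset_card_mono) force+
    qed
    then show ?thesis
      using that by (metis less_irrefl nat_neq_iff)
  qed
  moreover have "map (r \<alpha>) \<alpha> = map (r \<beta>) \<beta>"
    using assms by (simp add: pack_def r_def)
  then have "length \<alpha> = length \<beta>" "\<And>i. i < length \<alpha> \<Longrightarrow> r \<alpha> (\<alpha> ! i) = r \<beta> (\<beta> ! i)"
    by (metis length_map) (metis \<open>map (r \<alpha>) \<alpha> = map (r \<beta>) \<beta>\<close> length_map nth_map)
  ultimately have "\<alpha> ! i = \<alpha> ! j \<longleftrightarrow> \<beta> ! i = \<beta> ! j" if "i < length \<alpha>" "j < length \<alpha>" for i j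
    using that by (metis nth_mem)
  then show ?thesis
    using \<open>length \<alpha> = length \<beta>\<close> by (cases "\<alpha> = []") (auto simp: Tie_def)
qed

lemma shuffle_compatible_Tie: "shuffle_compatible Tie"
  unfolding shuffle_compatible_def
proof (intro conjI ballI impI; (elim conjE)?)
  fix \<alpha> \<beta> \<alpha>' \<beta>'
  assume *: "disjoint_words \<alpha> \<beta>" "disjoint_words \<alpha>' \<beta>'"
    "length \<alpha> = length \<alpha>'" "length \<beta> = length \<beta>'" "Tie \<alpha> = Tie \<alpha>'" "Tie \<beta> = Tie \<beta>'"
  show "image_mset Tie (Sh \<alpha> \<beta>) = image_mset Tie (Sh \<alpha>' \<beta>')"
  proof (cases "\<alpha> = [] \<or> \<beta> = []")
    case True
    then show ?thesis
      using * by auto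
  next
    case False
    then obtain a \<gamma> b \<delta> where \<alpha>: "\<alpha> = a # \<gamma>" and \<beta>: "\<beta> = b # \<delta>"
      by (meson neq_Nil_conv)
    obtain a' \<gamma>' b' \<delta>' where \<alpha>': "\<alpha>' = a' # \<gamma>'" and \<beta>': "\<beta>' = b' # \<delta>'"
      using *(3,4) \<alpha> \<beta> by (metis length_Suc_conv)
    have "image_mset (\<lambda>\<gamma>. Tie (a # \<gamma>)) (Sh \<gamma> \<beta>) = image_mset (\<lambda>\<gamma>. Tie (a' # \<gamma>)) (Sh \<gamma>' \<beta>')"
      using * by (intro image_Tie_Cons_Sh) (auto simp: \<alpha> \<alpha>' disjoint_words_def)
    moreover have "image_mset (\<lambda>\<gamma>. Tie (b # \<gamma>)) (Sh \<delta> \<alpha>) = image_mset (\<lambda>\<gamma>. Tie (b' # \<gamma>)) (Sh \<delta>' \<alpha>')"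
      using * by (intro image_Tie_Cons_Sh) (auto simp: \<beta> \<beta>' disjoint_words_def)
    ultimately show ?thesis
      by (simp add: \<alpha> \<alpha>' \<beta> \<beta>' multiset.map_comp comp_def Sh_commute[of "_ # _" \<delta>]
          Sh_commute[of "_ # _" \<delta>'])
  qed
qed (rule pack_eq_imp_Tie_eq)

section \<open>Run lengths of words as compositions\<close>

fun inc_hd :: "nat list \<Rightarrow> nat list" where
  "inc_hd [] = []"
| "inc_hd (n # u) = Suc n # u"

fun runs :: "'a list \<Rightarrow> nat list" where
  "runs [] = []"
| "runs [a] = [1]"
| "runs (a # b # w) = (if a = b then inc_hd (runs (b # w)) else 1 # runs (b # w))"

lemma inc_hd_eq_Nil_iff [simp]: "inc_hd u = [] \<longleftrightarrow> u = []"
  by (cases u) auto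

lemma runs_eq_Nil_iff [simp]: "runs \<alpha> = [] \<longleftrightarrow> \<alpha> = []"
  by (induction \<alpha> rule: runs.induct) auto

lemma runs_pos: "0 \<notin> set (runs \<alpha>)"
proof (induction \<alpha> rule: runs.induct)
  case (3 a b w)
  then show ?case by (cases "runs (b # w)") auto
qed auto

lemma sum_list_inc_hd: "u \<noteq> [] \<Longrightarrow> sum_list (inc_hd u) = Suc (sum_list u)"
  by (cases u) auto

lemma sum_list_runs: "sum_list (runs \<alpha>) = length \<alpha>"
  by (induction \<alpha> rule: runs.induct) (auto simp: sum_list_inc_hd)

lemma inc_hd_eq_iff: "inc_hd u = inc_hd v \<longleftrightarrow> u = v"
  by (cases u; cases v) auto

lemma inc_hd_neq_1: "0 \<notin> set u \<Longrightarrow> inc_hd u \<noteq> Suc 0 # v"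
  by (cases u) auto

text \<open>By positivity a lengthened first run has size at least 2 and cannot be confused with a
  new run of size 1, so the first gap can be recovered from the run lengths. Consequently the run
  lengths are a complete invariant of the tie class.\<close>

lemma runs_eq_iff:
  "runs \<alpha> = runs \<beta> \<longleftrightarrow> length \<alpha> = length \<beta> \<and> Tie \<alpha> = Tie \<beta>"
proof (cases "length \<alpha> = length \<beta>")
  case True
  then have "runs \<alpha> = runs \<beta> \<longleftrightarrow> Tie \<alpha> = Tie \<beta>"
  proof (induction \<alpha> arbitrary: \<beta> rule: runs.induct)
    case (3 a b v)
    then obtain c d w where \<beta>: "\<beta> = c # d # w"
      by (auto simp: length_Suc_conv Suc_length_conv)
    show ?case
      using 3 inc_hd_neq_1[OF runs_pos, of "b # v" "runs (d # w)"]
        inc_hd_neq_1[OF runs_pos, of "d # w" "runs (b # v)"]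
      unfolding \<beta> Tie_Cons_Cons_eq_iff by (auto simp: inc_hd_eq_iff)
  qed (auto simp: length_Suc_conv Suc_length_conv)
  then show ?thesis
    using True by simp
next
  case False
  then show ?thesis
    by (metis sum_list_runs)
qed

lemma runs_replicate_append:
  "0 < n \<Longrightarrow> w = [] \<or> hd w \<noteq> a \<Longrightarrow> runs (replicate n a @ w) = n # runs w"
proof (induction n rule: nat_induct_non_zero)
  case 1
  then show ?case by (cases w) auto
next
  case (Suc n)
  then show ?case by (cases n) auto
qed

text \<open>Together with \<open>runs_eq_iff\<close> this lets compositions label the basis of the
  tie set algebra.\<close>

lemma ex_word_runs:
  assumes "0 \<notin> set u"
  shows "\<exists>\<alpha>\<in>words. runs \<alpha> = u"
  using assms
proof (induction u)
  case Nil
  then show ?case by (auto simp: words_def intro!: bexI[of _ "[]"])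
next
  case (Cons n u)
  then obtain \<alpha> where \<alpha>: "\<alpha> \<in> words" "runs \<alpha> = u"
    by auto
  \<comment> \<open>The new run must not merge with the next one, and a successor is both different
    from \<open>hd \<alpha>\<close> and positive. For empty \<open>\<alpha>\<close> the value of
    \<open>hd\<close> is unspecified, but its successor is still a legal letter.\<close>
  define a where "a = Suc (hd \<alpha>)"
  have "runs (replicate n a @ \<alpha>) = n # u"
    using Cons.prems \<alpha> by (subst runs_replicate_append) (auto simp: a_def)
  moreover have "replicate n a @ \<alpha> \<in> words"
    using \<alpha> by (auto simp: words_def a_def)
  ultimately show ?case by blast
qed

section \<open>Block expansion\<close>

text \<open>The sequences of block lengths obtained by expanding every T gap as N + D.\<close>

fun block_expansion :: "'a list \<Rightarrow> nat list multiset" where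
  "block_expansion [] = {#[]#}"
| "block_expansion [a] = {#[1]#}"
| "block_expansion (a # b # w) = image_mset ((#) 1) (block_expansion (b # w)) +
     (if a = b then image_mset inc_hd (block_expansion (b # w)) else {#})"

text \<open>This is what makes the series attached to a word well defined on tie classes.\<close>

lemma block_expansion_Tie_cong:
  "length \<alpha> = length \<beta> \<Longrightarrow> Tie \<alpha> = Tie \<beta> \<Longrightarrow> block_expansion \<alpha> = block_expansion \<beta>"
proof (induction \<alpha> arbitrary: \<beta> rule: runs.induct)
  case (3 a b v)
  then obtain c d w where \<beta>: "\<beta> = c # d # w"
    by (auto simp: length_Suc_conv Suc_length_conv)
  then have "block_expansion (b # v) = block_expansion (d # w)"
    using 3 unfolding \<beta> Tie_Cons_Cons_eq_iff by (cases "a = b") auto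
  then show ?case
    using 3 unfolding \<beta> Tie_Cons_Cons_eq_iff by auto
qed (auto simp: length_Suc_conv Suc_length_conv)

lemma block_expansion_pos_sum:
  "u \<in># block_expansion \<alpha> \<Longrightarrow> 0 \<notin> set u \<and> sum_list u = length \<alpha>"
proof (induction \<alpha> arbitrary: u rule: runs.induct)
  case (3 a b w)
  have "v \<noteq> []" if "v \<in># block_expansion (b # w)" for v
    using 3(1,2)[of v] that by (cases "a = b") auto
  moreover have "0 \<notin> set v \<Longrightarrow> 0 \<notin> set (inc_hd v)" for v
    by (cases v) auto
  ultimately show ?case
    using 3 by (auto simp: sum_list_inc_hd split: if_splits)
qed auto

lemma block_expansion_Cons_not_Nil: "u \<in># block_expansion (a # \<alpha>) \<Longrightarrow> u \<noteq> []"
  using block_expansion_pos_sum by fastforce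

lemma length_inc_hd [simp]: "length (inc_hd u) = length u"
  by (cases u) auto

text \<open>Choosing D at every tie keeps all runs whole; choosing N at some tie cuts a run and so
  yields strictly more blocks.\<close>

lemma block_expansion_eq_runs:
  "\<exists>M. block_expansion \<alpha> = {#runs \<alpha>#} + M \<and> (\<forall>u\<in>#M. length (runs \<alpha>) < length u)"
proof (induction \<alpha> rule: runs.induct)
  case (3 a b w)
  then obtain M where M: "block_expansion (b # w) = {#runs (b # w)#} + M"
    "\<forall>u\<in>#M. length (runs (b # w)) < length u"
    by metis
  show ?case
  proof (cases "a = b")
    case True
    then show ?thesis
      using M by (intro exI[of _ "image_mset ((#) 1) (block_expansion (b # w)) + image_mset inc_hd M"])
        auto
  next
    case False
    then show ?thesis
      using M by (intro exI[of _ "image_mset ((#) 1) M"]) auto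
  qed
qed auto

lemma Sh_hd_tl:
  "u \<noteq> [] \<Longrightarrow> v \<noteq> [] \<Longrightarrow> Sh u v = image_mset ((#) (hd u)) (Sh (tl u) v) + image_mset ((#) (hd v)) (Sh (tl v) u)"
  by (cases u; cases v) (auto simp: Sh_commute)

lemma inc_hd_Cons_hd: "u \<noteq> [] \<Longrightarrow> hd (inc_hd u) # w = inc_hd (hd u # w) \<and> tl (inc_hd u) = tl u"
  by (cases u) auto

text \<open>When \<open>x\<close> comes first, the whole block of \<open>x\<close> comes first as
  well: a D gap needs a tie, and a letter of \<open>\<beta>\<close> never ties with
  \<open>x\<close>. Hence \<open>hd u\<close> stays in front and only the later blocks are shuffled.
  Stating this for an arbitrary \<open>F\<close> lets the induction absorb the operations
  \<open>(#) 1\<close> and \<open>inc_hd\<close> into \<open>F\<close>.\<close>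

lemma sum_block_expansion_Cons_Sh:
  fixes F :: "nat list \<Rightarrow> 'b :: comm_monoid_add"
  assumes "set (x # \<alpha>) \<inter> set \<beta> = {}"
  shows "(\<Sum>\<gamma>\<in>#Sh \<alpha> \<beta>. \<Sum>u\<in>#block_expansion (x # \<gamma>). F u) =
    (\<Sum>u\<in>#block_expansion (x # \<alpha>). \<Sum>v\<in>#block_expansion \<beta>. \<Sum>w\<in>#Sh (tl u) v. F (hd u # w))"
  using assms
proof (induction "length \<alpha> + length \<beta>" arbitrary: x \<alpha> \<beta> F rule: less_induct)
  case less
  consider "\<alpha> = []" | "\<beta> = []" | a \<gamma> b \<delta> where "\<alpha> = a # \<gamma>" "\<beta> = b # \<delta>"
    by (meson neq_Nil_conv)
  then show ?case
  proof cases
    case 1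
    then show ?thesis
      using less.prems by (cases \<beta>) (auto simp: multiset.map_comp comp_def)
  next
    case 2
    then show ?thesis
      by (auto intro!: arg_cong[of _ _ sum_mset] image_mset_cong dest: block_expansion_Cons_not_Nil)
  next
    case 3
    have ne: "x \<noteq> b" and d: "set (a # \<gamma>) \<inter> set \<beta> = {}" "set (b # \<delta>) \<inter> set \<alpha> = {}"
      using less.prems 3 by auto
    have 1: "(\<Sum>\<gamma>\<in>#Sh \<gamma> \<beta>. \<Sum>u\<in>#block_expansion (a # \<gamma>). F u) =
        (\<Sum>u\<in>#block_expansion \<alpha>. \<Sum>v\<in>#block_expansion \<beta>. \<Sum>w\<in>#Sh (tl u) v. F (hd u # w))"
      for F :: "nat list \<Rightarrow> 'b"
      unfolding 3(1) using d by (intro less.hyps) (simp_all add: 3)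
    have 2: "(\<Sum>\<gamma>\<in>#Sh \<delta> \<alpha>. \<Sum>v\<in>#block_expansion (b # \<gamma>). F v) =
        (\<Sum>u\<in>#block_expansion \<alpha>. \<Sum>v\<in>#block_expansion \<beta>. \<Sum>w\<in>#Sh (tl v) u. F (hd v # w))"
      for F :: "nat list \<Rightarrow> 'b"
      unfolding 3(2) using d by (subst sum_mset.swap, intro less.hyps) (simp_all add: 3)
    \<comment> \<open>An N gap after \<open>x\<close> makes \<open>x\<close> a block of its own.
      What follows is an unrestricted shuffle of the blocks of both words, split according to the
      word that supplies its first block.\<close>
    have N: "(\<Sum>u\<in>#block_expansion \<alpha>. \<Sum>v\<in>#block_expansion \<beta>. \<Sum>w\<in>#Sh u v. F (1 # w)) =
        (\<Sum>\<gamma>\<in>#Sh \<gamma> \<beta>. \<Sum>u\<in>#block_expansion (a # \<gamma>). F (1 # u)) +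
        (\<Sum>\<gamma>\<in>#Sh \<delta> \<alpha>. \<Sum>v\<in>#block_expansion (b # \<gamma>). F (1 # v))"
      unfolding 1 2 sum_mset.distrib[symmetric] unfolding 3
      by (intro arg_cong[of _ _ sum_mset] image_mset_cong, subst Sh_hd_tl)
        (auto dest: block_expansion_Cons_not_Nil simp: multiset.map_comp comp_def)
    \<comment> \<open>A D gap after \<open>x\<close> forces the next letter to come from
      \<open>\<alpha>\<close> and enlarges its block.\<close>
    have D: "(\<Sum>u\<in>#block_expansion \<alpha>. \<Sum>v\<in>#block_expansion \<beta>.
          \<Sum>w\<in>#Sh (tl (inc_hd u)) v. F (hd (inc_hd u) # w)) =
        (\<Sum>\<gamma>\<in>#Sh \<gamma> \<beta>. \<Sum>u\<in>#block_expansion (a # \<gamma>). F (inc_hd u))"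
      unfolding 1 unfolding 3
      by (intro arg_cong[of _ _ sum_mset] image_mset_cong)
        (auto dest!: block_expansion_Cons_not_Nil simp: inc_hd_Cons_hd)
    have "(\<Sum>\<gamma>\<in>#Sh \<alpha> \<beta>. \<Sum>u\<in>#block_expansion (x # \<gamma>). F u) =
       (\<Sum>\<gamma>\<in>#Sh \<gamma> \<beta>. \<Sum>u\<in>#block_expansion (x # a # \<gamma>). F u) +
       (\<Sum>\<gamma>\<in>#Sh \<delta> \<alpha>. \<Sum>v\<in>#block_expansion (x # b # \<gamma>). F v)"
      unfolding 3 by (simp add: multiset.map_comp comp_def Sh_commute[of \<delta>] del: block_expansion.simps)
    also have "\<dots> = (\<Sum>u\<in>#block_expansion \<alpha>. \<Sum>v\<in>#block_expansion \<beta>. \<Sum>w\<in>#Sh u v. F (1 # w)) +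
       (if x = a then \<Sum>u\<in>#block_expansion \<alpha>. \<Sum>v\<in>#block_expansion \<beta>.
          \<Sum>w\<in>#Sh (tl (inc_hd u)) v. F (hd (inc_hd u) # w) else 0)"
      unfolding N D using ne by (simp add: multiset.map_comp comp_def sum_mset.distrib ac_simps)
    also have "\<dots> = (\<Sum>u\<in>#block_expansion (x # \<alpha>). \<Sum>v\<in>#block_expansion \<beta>. \<Sum>w\<in>#Sh (tl u) v. F (hd u # w))"
      unfolding 3 by (simp add: multiset.map_comp comp_def)
    finally show ?thesis .
  qed
qed

text \<open>Multiplicativity of the expansion, with blocks acting as single letters. Equal parts of
  \<open>u\<close> and \<open>v\<close> belong to different blocks, which is why interleavings must
  be counted with multiplicity.\<close>

lemma sum_block_expansion_Sh:
  fixes F :: "nat list \<Rightarrow> 'b :: comm_monoid_add"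
  assumes "set \<alpha> \<inter> set \<beta> = {}"
  shows "(\<Sum>\<gamma>\<in>#Sh \<alpha> \<beta>. \<Sum>u\<in>#block_expansion \<gamma>. F u) =
    (\<Sum>u\<in>#block_expansion \<alpha>. \<Sum>v\<in>#block_expansion \<beta>. \<Sum>w\<in>#Sh u v. F w)"
proof -
  consider "\<alpha> = []" | "\<beta> = []" | a \<gamma> b \<delta> where "\<alpha> = a # \<gamma>" "\<beta> = b # \<delta>"
    by (meson neq_Nil_conv)
  then show ?thesis
  proof cases
    case 3
    have "(\<Sum>u\<in>#block_expansion \<alpha>. \<Sum>v\<in>#block_expansion \<beta>. \<Sum>w\<in>#Sh u v. F w) =
      (\<Sum>u\<in>#block_expansion \<alpha>. \<Sum>v\<in>#block_expansion \<beta>. \<Sum>w\<in>#Sh (tl u) v. F (hd u # w)) +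
      (\<Sum>u\<in>#block_expansion \<alpha>. \<Sum>v\<in>#block_expansion \<beta>. \<Sum>w\<in>#Sh (tl v) u. F (hd v # w))"
      unfolding sum_mset.distrib[symmetric] 3
      by (intro arg_cong[of _ _ sum_mset] image_mset_cong, subst Sh_hd_tl)
        (auto dest: block_expansion_Cons_not_Nil simp: multiset.map_comp comp_def)
    also have "\<dots> = (\<Sum>\<gamma>\<in>#Sh \<gamma> \<beta>. \<Sum>u\<in>#block_expansion (a # \<gamma>). F u) +
        (\<Sum>\<gamma>\<in>#Sh \<delta> \<alpha>. \<Sum>v\<in>#block_expansion (b # \<gamma>). F v)"
      unfolding 3
      by (subst (2) sum_mset.swap, intro arg_cong2[of _ _ _ _ "(+)"] sum_block_expansion_Cons_Sh[symmetric])
        (use assms 3 in auto)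
    also have "\<dots> = (\<Sum>\<gamma>\<in>#Sh \<alpha> \<beta>. \<Sum>u\<in>#block_expansion \<gamma>. F u)"
      unfolding 3 by (simp add: multiset.map_comp comp_def Sh_commute[of \<delta>] del: block_expansion.simps)
    finally show ?thesis ..
  qed auto
qed

section \<open>Hoffman's exponential\<close>

text \<open>Coefficient of a monomial with exponents \<open>e\<close> (zeros allowed) in the image of the composition
  \<open>u\<close> under Hoffman's isomorphism from the shuffle algebra to the quasi-shuffle algebra: \<open>u\<close> is cut
  into consecutive segments with sums \<open>e\<close>, a segment with \<open>k\<close> parts having weight \<open>1 / k!\<close>.\<close>

fun hoffman_coeff :: "nat list \<Rightarrow> nat list \<Rightarrow> rat" where
  "hoffman_coeff u [] = of_bool (u = [])"
| "hoffman_coeff u (x # e) =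
     (\<Sum>k\<le>length u. of_bool (sum_list (take k u) = x) / fact k * hoffman_coeff (drop k u) e)"

text \<open>Coefficient of a product of two series in finitely many variables, at an exponent vector
  of fixed length. The recursion on variables matches that of \<open>hoffman_coeff\<close>.\<close>

fun list_conv :: "(nat list \<Rightarrow> 'a) \<Rightarrow> (nat list \<Rightarrow> 'a) \<Rightarrow> nat list \<Rightarrow> 'a :: comm_semiring_1" where
  "list_conv f g [] = f [] * g []"
| "list_conv f g (x # e) = (\<Sum>i\<le>x. list_conv (\<lambda>p. f (i # p)) (\<lambda>q. g ((x - i) # q)) e)"

lemma list_conv_sum_left:
  "list_conv (\<lambda>p. \<Sum>k\<in>K. c k * f k p) g e = (\<Sum>k\<in>K. c k * list_conv (f k) g e)"
proof (induction e arbitrary: f g)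
  case (Cons x e)
  then show ?case
    by (simp add: sum_distrib_left) (rule sum.swap)
qed (simp add: sum_distrib_right mult.assoc)

lemma list_conv_commute: "list_conv f g e = list_conv g f e"
proof (induction e arbitrary: f g)
  case (Cons x e)
  have "(\<Sum>i\<le>x. list_conv (\<lambda>p. g (i # p)) (\<lambda>q. f ((x - i) # q)) e) =
      (\<Sum>i\<le>x. list_conv (\<lambda>p. g ((x - i) # p)) (\<lambda>q. f (i # q)) e)"
    by (rule sum.reindex_bij_witness[of _ "\<lambda>i. x - i" "\<lambda>i. x - i"]) auto
  then show ?case
    by (simp add: Cons)
qed (simp add: mult.commute)

lemma list_conv_sum_right:
  "list_conv f (\<lambda>p. \<Sum>k\<in>K. c k * g k p) e = (\<Sum>k\<in>K. c k * list_conv f (g k) e)"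
  by (simp add: list_conv_commute[of f] list_conv_sum_left)

text \<open>Provides the index set that is later matched with factorizations of a monomial. Since
  \<open>map2\<close> truncates to the shorter list, equality of the lengths is demanded
  separately.\<close>

lemma list_conv_eq_sum:
  "list_conv f g e =
     (\<Sum>(p, q) | length p = length q \<and> map2 (+) p q = e. f p * g q)"
proof (induction e arbitrary: f g)
  case Nil
  have "{(p, q). length p = length q \<and> (p = [] \<or> q = [])} = {([] :: nat list, [] :: nat list)}"
    by auto
  then show ?case by simp
next
  case (Cons x e)
  define LD where "LD = (\<lambda>e :: nat list. {(p, q). length p = length q \<and> map2 (+) p q = e})"
  have LD_Cons: "(p, q) \<in> LD (x # e) \<longleftrightarrow>
      (\<exists>i p' q'. p = i # p' \<and> q = (x - i) # q' \<and> i \<le> x \<and> (p', q') \<in> LD e)" for p q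
    by (cases p; cases q) (auto simp: LD_def)
  have "list_conv f g (x # e) = (\<Sum>i\<le>x. \<Sum>(p, q)\<in>LD e. f (i # p) * g ((x - i) # q))"
    by (simp add: Cons LD_def)
  also have "\<dots> = (\<Sum>(i, p, q)\<in>{..x} \<times> LD e. f (i # p) * g ((x - i) # q))"
    by (subst sum.cartesian_product) (simp add: case_prod_unfold)
  also have "\<dots> = (\<Sum>(p, q)\<in>LD (x # e). f p * g q)"
    by (rule sum.reindex_bij_witness[of _ "\<lambda>(p, q). (hd p, tl p, tl q)"
          "\<lambda>(i, p, q). (i # p, (x - i) # q)"])
      (auto simp: LD_Cons)
  finally show ?case
    by (simp add: LD_def)
qed

lemma sum_atMost_Suc_Cons_splits:
  fixes F :: "'a list \<Rightarrow> 'a list \<Rightarrow> 'b :: comm_monoid_add"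
  shows "(\<Sum>k\<le>Suc n. F (take k (a # w)) (drop k (a # w))) =
    F [] (a # w) + (\<Sum>k\<le>n. F (a # take k w) (drop k w))"
  by (simp only: sum.atMost_Suc_shift) simp

text \<open>Deconcatenation is multiplicative for shuffles: the letters before the cut form a
  shuffle of prefixes of the two words, those after it a shuffle of the corresponding
  suffixes.\<close>

lemma sum_splits_Sh:
  fixes F :: "'a list \<Rightarrow> 'a list \<Rightarrow> 'b :: comm_monoid_add"
  shows "(\<Sum>w\<in>#Sh u v. \<Sum>k\<le>length w. F (take k w) (drop k w)) =
    (\<Sum>i\<le>length u. \<Sum>j\<le>length v. \<Sum>p\<in>#Sh (take i u) (take j v). \<Sum>q\<in>#Sh (drop i u) (drop j v). F p q)"
proof (induction u v arbitrary: F rule: Sh.induct)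
  case (3 a u b v)
  show ?case
    by (simp add: multiset.map_comp comp_def sum_atMost_Suc_Cons_splits sum_mset.distrib
        3(1)[of "\<lambda>p. F (a # p)"] 3(2)[of "\<lambda>p. F (b # p)"] sum.atMost_Suc_shift sum.distrib del: sum.atMost_Suc)
      (simp add: ac_simps)
qed simp_all

lemma Sh_length_sum_list:
  assumes "w \<in># Sh u v"
  shows "length w = length u + length v" "sum_list w = sum_list u + sum_list (v :: nat list)"
  using assms by (induction u v arbitrary: w rule: Sh.induct) auto

text \<open>Hoffman's map is multiplicative. Cutting off the segment that belongs to the first
  variable separates the claim into a count for one segment and the induction hypothesis for the
  remaining variables.\<close>

lemma sum_hoffman_coeff_Sh:
  "(\<Sum>w\<in>#Sh u v. hoffman_coeff w e) = list_conv (hoffman_coeff u) (hoffman_coeff v) e"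
proof (induction e arbitrary: u v)
  case Nil
  have "(\<Sum>w\<in>#Sh u v. of_bool (w = [])) = (of_bool (u = []) * of_bool (v = []) :: rat)"
    by (cases u; cases v) (simp_all add: multiset.map_comp comp_def)
  then show ?case by simp
next
  case (Cons x e)
  define c where "c = (\<lambda>y (u :: nat list). of_bool (sum_list u = y) / fact (length u) :: rat)"
  have step: "hoffman_coeff w (y # e) = (\<Sum>k\<le>length w. c y (take k w) * hoffman_coeff (drop k w) e)"
    for w y e
    by (auto simp: c_def intro!: sum.cong)
  \<comment> \<open>All shuffles have the same length and sum, so their weights agree and only their
    number matters; the binomial coefficient divided by the factorial of the total length is the
    product of the two weights. The sum over \<open>y\<close> has at most one nonzero term, at
    \<open>sum_list u\<close>.\<close>
  have c_Sh: "(\<Sum>p\<in>#Sh u v. c x p) = (\<Sum>y\<le>x. c y u * c (x - y) v)" for u v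
  proof -
    have "(\<Sum>p\<in>#Sh u v. c x p) =
        (\<Sum>p\<in>#Sh u v. of_bool (sum_list u + sum_list v = x) / fact (length u + length v))"
      by (intro arg_cong[of _ _ sum_mset] image_mset_cong)
        (simp add: c_def Sh_length_sum_list)
    also have "\<dots> = of_bool (sum_list u + sum_list v = x) / (fact (length u) * fact (length v))"
      by (simp add: size_Sh binomial_fact)
    also have "\<dots> = (\<Sum>y\<le>x. if y = sum_list u then
        of_bool (sum_list u + sum_list v = x) / (fact (length u) * fact (length v)) else 0)"
      by (subst sum.delta) auto
    also have "\<dots> = (\<Sum>y\<le>x. c y u * c (x - y) v)"
      by (intro sum.cong) (auto simp: c_def)
    finally show ?thesis .
  qed
  have "(\<Sum>w\<in>#Sh u v. hoffman_coeff w (x # e)) =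
    (\<Sum>i\<le>length u. \<Sum>j\<le>length v. \<Sum>p\<in>#Sh (take i u) (take j v).
       \<Sum>q\<in>#Sh (drop i u) (drop j v). c x p * hoffman_coeff q e)"
    unfolding step by (rule sum_splits_Sh)
  also have "\<dots> = (\<Sum>i\<le>length u. \<Sum>j\<le>length v. (\<Sum>y\<le>x. c y (take i u) * c (x - y) (take j v)) *
       list_conv (hoffman_coeff (drop i u)) (hoffman_coeff (drop j v)) e)"
    by (simp only: sum_mset_distrib_left[symmetric] sum_mset_distrib_right[symmetric] Cons c_Sh)
  also have "\<dots> = (\<Sum>y\<le>x. \<Sum>i\<le>length u. \<Sum>j\<le>length v. c y (take i u) * (c (x - y) (take j v) *
       list_conv (hoffman_coeff (drop i u)) (hoffman_coeff (drop j v)) e))"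
    by (subst (2) sum.swap, subst sum.swap) (simp add: sum_distrib_right mult.assoc)
  also have "\<dots> = list_conv (hoffman_coeff u) (hoffman_coeff v) (x # e)"
    by (simp only: list_conv.simps step list_conv_sum_left list_conv_sum_right sum_distrib_left)
  finally show ?case .
qed

section \<open>Zero exponents and triangularity of the Hoffman coefficients\<close>

lemma sum_list_take_eq_0_iff:
  assumes "(0 :: nat) \<notin> set u" "k \<le> length u"
  shows "sum_list (take k u) = 0 \<longleftrightarrow> k = 0"
  using assms by (cases u; cases k) auto

text \<open>A segment of positive parts with sum 0 is empty, and its weight is 1 / 0! = 1.\<close>

lemma hoffman_coeff_Cons_0:
  assumes "0 \<notin> set u"
  shows "hoffman_coeff u (0 # e) = hoffman_coeff u e"
proof -
  have "hoffman_coeff u (0 # e) = (\<Sum>k\<le>length u. if k = 0 then hoffman_coeff u e else 0)"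
    unfolding hoffman_coeff.simps using assms sum_list_take_eq_0_iff[OF assms]
    by (intro sum.cong) auto
  then show ?thesis
    by (simp add: sum.delta)
qed

text \<open>Allows exponent vectors to be padded with zeros to a common length, and is at the same
  time the source of quasisymmetry.\<close>

lemma hoffman_coeff_filter:
  "0 \<notin> set u \<Longrightarrow> hoffman_coeff u (filter ((\<noteq>) 0) e) = hoffman_coeff u e"
proof (induction e arbitrary: u)
  case (Cons x e)
  have "hoffman_coeff (drop k u) (filter ((\<noteq>) 0) e) = hoffman_coeff (drop k u) e" for k
    using Cons.prems by (intro Cons.IH) (auto dest: in_set_dropD)
  then show ?case
    using Cons by (cases "x = 0") (simp_all add: hoffman_coeff_Cons_0 del: hoffman_coeff.simps(2),
        simp add: hoffman_coeff.simps(2))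
qed simp

text \<open>A nonzero coefficient means that \<open>e\<close> arises from \<open>u\<close> by
  merging consecutive parts; positive exponents rule out empty segments. If no part is lost, every
  segment is a single part.\<close>

lemma hoffman_coeff_nonzeroD:
  assumes "0 \<notin> set u" "0 \<notin> set e" "hoffman_coeff u e \<noteq> 0"
  shows "sum_list u = sum_list e \<and> length e \<le> length u \<and> (length e = length u \<longrightarrow> e = u)"
  using assms
proof (induction e arbitrary: u)
  case (Cons x e)
  obtain k where "k \<in> {..length u}"
    "of_bool (sum_list (take k u) = x) / fact k * hoffman_coeff (drop k u) e \<noteq> 0"
    using Cons.prems(3) unfolding hoffman_coeff.simps by (rule sum.not_neutral_contains_not_neutral)
  then have k: "k \<le> length u" "sum_list (take k u) = x" "hoffman_coeff (drop k u) e \<noteq> 0"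
    by auto
  have "k > 0"
    using k Cons.prems by (intro Nat.gr0I) auto
  have IH: "sum_list (drop k u) = sum_list e" "length e \<le> length (drop k u)"
    "length e = length (drop k u) \<Longrightarrow> e = drop k u"
    using Cons.IH[of "drop k u"] Cons.prems k by (auto dest: in_set_dropD)
  have "sum_list u = x + sum_list e"
    using k(2) IH(1) by (metis append_take_drop_id sum_list_append)
  moreover have "x # e = u" if "length (x # e) = length u"
  proof -
    have "k = 1"
      using that IH(2) \<open>k > 0\<close> k(1) by simp
    then show ?thesis
      using that IH(3) k(1,2) by (cases u) auto
  qed
  ultimately show ?case
    using IH(2) \<open>k > 0\<close> k(1) by auto
qed auto

text \<open>The diagonal of the triangular matrix: by positivity, the segment with sum
  \<open>x\<close> can only be the first part itself, with weight 1 / 1!.\<close>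

lemma hoffman_coeff_self:
  "0 \<notin> set u \<Longrightarrow> hoffman_coeff u u = 1"
proof (induction u)
  case (Cons x u)
  have "hoffman_coeff (x # u) (x # u) = (\<Sum>k\<le>Suc (length u). if k = 1 then 1 else 0)"
    unfolding hoffman_coeff.simps list.size add_0_right add_Suc_right
  proof (rule sum.cong)
    fix k assume "k \<in> {..Suc (length u)}"
    then show "of_bool (sum_list (take k (x # u)) = x) / fact k * hoffman_coeff (drop k (x # u)) u =
        (if k = 1 then 1 else 0)"
      using Cons sum_list_take_eq_0_iff[of u "k - 1"] by (cases k) auto
  qed simp
  then show ?case
    by (simp add: sum.delta del: hoffman_coeff.simps sum.atMost_Suc)
qed simp

section \<open>Exponent sequences of monomials\<close>

text \<open>The composition indexing the monomial quasisymmetric function in which \<open>m\<close>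
  occurs.\<close>

definition exponents :: "(nat \<Rightarrow>\<^sub>0 nat) \<Rightarrow> nat list" where
  "exponents m = map (Poly_Mapping.lookup m) (sorted_list_of_set (Poly_Mapping.keys m))"

lemma exponents_pos: "0 \<notin> set (exponents m)"
  by (auto simp: exponents_def in_keys_iff)

lemma exponents_eq_filter:
  assumes "Poly_Mapping.keys m \<subseteq> {..<N}"
  shows "exponents m = filter ((\<noteq>) 0) (map (Poly_Mapping.lookup m) [0..<N])"
proof -
  have "sorted_list_of_set (Poly_Mapping.keys m) = filter (\<lambda>i. 0 \<noteq> Poly_Mapping.lookup m i) [0..<N]"
    using assms by (intro sorted_distinct_set_unique) (auto simp: in_keys_iff sorted_wrt_filter)
  then show ?thesis
    by (simp add: exponents_def filter_map comp_def)
qed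

lemma exponents_0 [simp]: "exponents 0 = []"
  by (simp add: exponents_def)

lemma exponents_eq_Nil_iff [simp]: "exponents m = [] \<longleftrightarrow> m = 0"
  by (simp add: exponents_def)

lemma sum_list_exponents: "sum_list (exponents m) = monomial_degree m"
  by (simp add: exponents_def monomial_degree_def sum_list_distinct_conv_sum_set)

lemma monomial_of_Cons [simp]:
  "monomial_of (i # is) (e # es) = Poly_Mapping.single i e + monomial_of is es"
  by (simp add: monomial_of_def)

lemma lookup_monomial_of_map:
  "distinct is \<Longrightarrow>
     Poly_Mapping.lookup (monomial_of is (map f is)) j = (if j \<in> set is then f j else 0)"
proof (induction "is")
  case Nil
  then show ?case by (simp add: monomial_of_def)
next
  case (Cons i "is")
  then show ?case by (auto simp: lookup_add lookup_single when_def)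
qed

lemma monomial_of_exponents:
  "monomial_of (sorted_list_of_set (Poly_Mapping.keys m)) (exponents m) = m"
  by (rule poly_mapping_eqI) (simp add: exponents_def lookup_monomial_of_map in_keys_iff)

lemma exponents_monomial_of:
  assumes "0 \<notin> set es" "length is = length es" "sorted_wrt (<) is"
  shows "exponents (monomial_of is es) = es"
proof -
  have d: "distinct is" "sorted is"
    using assms strict_sorted_iff by auto
  \<comment> \<open>As the indices are distinct, the exponents are a function of the index, the form
    handled by \<open>lookup_monomial_of_map\<close>.\<close>
  define f where "f = (\<lambda>i. the (map_of (zip is es) i))"
  have es: "es = map f is"
  proof (rule nth_equalityI)
    fix i assume "i < length es"
    then show "es ! i = map f is ! i"
      using assms d map_of_zip_nth[of "is" es i] by (simp add: f_def)
  qed (simp add: assms)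
  have "Poly_Mapping.keys (monomial_of is es) = set is"
    using assms(1) d by (auto simp: es in_keys_iff lookup_monomial_of_map image_iff split: if_splits)
  then show ?thesis
    using d by (simp add: exponents_def sorted_list_of_set.idem_if_sorted_distinct)
      (simp add: es lookup_monomial_of_map)
qed

lemma ex_monomial_exponents: "0 \<notin> set e \<Longrightarrow> \<exists>m. exponents m = e"
  by (rule exI[of _ "monomial_of [0..<length e] e"]) (simp add: exponents_monomial_of)

text \<open>Every monomial is recovered from its sorted support and its exponents, so the condition
  on pairs of index lists says that coefficients depend on \<open>exponents\<close> alone.\<close>

lemma quasisymmetric_iff:
  "quasisymmetric f \<longleftrightarrow> (\<exists>d. \<forall>m. f m \<noteq> 0 \<longrightarrow> monomial_degree m \<le> d) \<and>
     (\<forall>m m'. exponents m = exponents m' \<longrightarrow> f m = f m')"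
proof -
  have "(\<forall>es is js. (\<forall>e\<in>set es. 0 < e) \<and>
        length is = length es \<and> length js = length es \<and>
        sorted_wrt (<) is \<and> sorted_wrt (<) js \<longrightarrow>
        f (monomial_of is es) = f (monomial_of js es)) \<longleftrightarrow>
     (\<forall>m m'. exponents m = exponents m' \<longrightarrow> f m = f m')" (is "?L \<longleftrightarrow> ?R")
  proof
    assume L: ?L
    show ?R
    proof (intro allI impI)
      fix m m' assume eq: "exponents m = exponents m'"
      have "f (monomial_of (sorted_list_of_set (Poly_Mapping.keys m)) (exponents m)) =
        f (monomial_of (sorted_list_of_set (Poly_Mapping.keys m')) (exponents m))"
        using exponents_pos[of m] arg_cong[OF eq, of length]
        by (intro L[rule_format]) (auto simp: exponents_def intro: Nat.gr0I)
      then show "f m = f m'"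
        using monomial_of_exponents[of m] monomial_of_exponents[of m'] eq by simp
    qed
  next
    assume R: ?R
    show ?L
      by (intro allI impI R[rule_format], elim conjE, subst (1 2) exponents_monomial_of) auto
  qed
  then show ?thesis
    unfolding quasisymmetric_def by simp
qed

text \<open>The product of \<open>QSym\<close> on arbitrary power series, so that its laws can be
  proved before closure of the quasisymmetric ones is known.\<close>

definition series_mult :: "power_series \<Rightarrow> power_series \<Rightarrow> power_series" where
  "series_mult f g m = (\<Sum>(p, q) | p + q = m. f p * g q)"

lemma series_mult_list_conv:
  assumes N: "Poly_Mapping.keys m \<subseteq> {..<N}"
  shows "(\<Sum>(p, q) | p + q = m. f (map (Poly_Mapping.lookup p) [0..<N]) *
      g (map (Poly_Mapping.lookup q) [0..<N])) =
    list_conv f g (map (Poly_Mapping.lookup m) [0..<N])"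
  unfolding list_conv_eq_sum
proof (rule sum.reindex_bij_witness[of _ "\<lambda>(P, Q). (Poly_Mapping.nth P, Poly_Mapping.nth Q)"
      "\<lambda>(p, q). (map (Poly_Mapping.lookup p) [0..<N], map (Poly_Mapping.lookup q) [0..<N])"])
  fix a assume "a \<in> {(p, q). p + q = m}"
  then obtain p q where a: "a = (p, q)" "p + q = m"
    by auto
  \<comment> \<open>Natural exponents cannot cancel, so a variable absent from \<open>m\<close> is
    absent from both factors and restricting to \<open>N\<close> variables loses nothing.\<close>
  have "Poly_Mapping.lookup p i = 0 \<and> Poly_Mapping.lookup q i = 0" if "\<not> i < N" for i
  proof -
    have "i \<notin> Poly_Mapping.keys m"
      using N that by auto
    then show ?thesis
      by (simp add: a(2)[symmetric] in_keys_iff lookup_add)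
  qed
  then show "(case case a of (p, q) \<Rightarrow> (map (Poly_Mapping.lookup p) [0..<N],
      map (Poly_Mapping.lookup q) [0..<N]) of
      (P, Q) \<Rightarrow> (Poly_Mapping.nth P, Poly_Mapping.nth Q)) = a"
    by (auto intro!: poly_mapping_eqI simp: a nth_default_def)
  show "(case a of (p, q) \<Rightarrow> (map (Poly_Mapping.lookup p) [0..<N], map (Poly_Mapping.lookup q) [0..<N]))
    \<in> {(P, Q). length P = length Q \<and> map2 (+) P Q = map (Poly_Mapping.lookup m) [0..<N]}"
    by (auto intro!: nth_equalityI simp: a(1) a(2)[symmetric] lookup_add)
next
  fix b
  assume "b \<in> {(P, Q). length P = length Q \<and> map2 (+) P Q = map (Poly_Mapping.lookup m) [0..<N]}"
  then obtain P Q where b: "b = (P, Q)" and PQ: "length P = length Q"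
    "map2 (+) P Q = map (Poly_Mapping.lookup m) [0..<N]"
    by blast
  have "length P = N"
    using arg_cong[OF PQ(2), of length] PQ(1) by simp
  note * = this this[unfolded PQ(1)] PQ(2)
  show "(case case b of (P, Q) \<Rightarrow> (Poly_Mapping.nth P, Poly_Mapping.nth Q) of
      (p, q) \<Rightarrow> (map (Poly_Mapping.lookup p) [0..<N], map (Poly_Mapping.lookup q) [0..<N])) = b"
    using * by (auto intro!: nth_equalityI simp: b nth_default_def)
  have "P ! i + Q ! i = Poly_Mapping.lookup m i" if "i < N" for i
    using arg_cong[OF *(3), of "\<lambda>xs. xs ! i"] *(1,2) that by simp
  moreover have "Poly_Mapping.lookup m i = 0" if "\<not> i < N" for i
    using N that by (metis in_keys_iff lessThan_iff subsetD)
  ultimately show "(case b of (P, Q) \<Rightarrow> (Poly_Mapping.nth P, Poly_Mapping.nth Q)) \<in> {(p, q). p + q = m}"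
    using * by (auto intro!: poly_mapping_eqI simp: b nth_default_def lookup_add)
qed auto

text \<open>Since \<open>exponents\<close> forgets which variables occur, it does not respect
  addition of monomials. Padding with zeros to a common number \<open>N\<close> of variables makes
  addition coordinatewise, and the Hoffman coefficients do not notice the padding.\<close>

lemma sum_hoffman_coeff_exponents_Sh:
  assumes u: "0 \<notin> set u" and v: "0 \<notin> set v"
  shows "series_mult (\<lambda>m. hoffman_coeff u (exponents m)) (\<lambda>m. hoffman_coeff v (exponents m)) m =
    (\<Sum>w\<in>#Sh u v. hoffman_coeff w (exponents m))"
proof -
  obtain N where N: "Poly_Mapping.keys m \<subseteq> {..<N}"
    using finite_nat_bounded[of "Poly_Mapping.keys m"] by auto
  have H: "hoffman_coeff w (exponents p) = hoffman_coeff w (map (Poly_Mapping.lookup p) [0..<N])"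
    if "0 \<notin> set w" "Poly_Mapping.keys p \<subseteq> {..<N}" for w p
    using that by (metis exponents_eq_filter hoffman_coeff_filter)
  have K: "Poly_Mapping.keys p \<subseteq> {..<N} \<and> Poly_Mapping.keys q \<subseteq> {..<N}" if "p + q = m" for p q
  proof -
    have "Poly_Mapping.keys p \<union> Poly_Mapping.keys q \<subseteq> Poly_Mapping.keys m"
      using that by (auto simp: in_keys_iff lookup_add)
    then show ?thesis
      using N by blast
  qed
  have W: "0 \<notin> set w" if "w \<in># Sh u v" for w
    using that u v by (auto simp: set_mset_Sh set_shuffles)
  have "series_mult (\<lambda>m. hoffman_coeff u (exponents m)) (\<lambda>m. hoffman_coeff v (exponents m)) m =
    (\<Sum>(p, q) | p + q = m. hoffman_coeff u (map (Poly_Mapping.lookup p) [0..<N]) *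
      hoffman_coeff v (map (Poly_Mapping.lookup q) [0..<N]))"
    unfolding series_mult_def using K u v by (intro sum.cong) (auto simp: H)
  also have "\<dots> = (\<Sum>w\<in>#Sh u v. hoffman_coeff w (map (Poly_Mapping.lookup m) [0..<N]))"
    using N by (simp only: series_mult_list_conv sum_hoffman_coeff_Sh)
  also have "\<dots> = (\<Sum>w\<in>#Sh u v. hoffman_coeff w (exponents m))"
    using N W by (intro arg_cong[of _ _ sum_mset] image_mset_cong) (simp add: H)
  finally show ?thesis .
qed

section \<open>The algebra of quasisymmetric functions\<close>

lemma QSym_simps:
  "carrier QSym = {f. quasisymmetric f}"
  "f \<otimes>\<^bsub>QSym\<^esub> g = series_mult f g"
  "\<one>\<^bsub>QSym\<^esub> = (\<lambda>m. if m = 0 then 1 else 0)"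
  "\<zero>\<^bsub>QSym\<^esub> = (\<lambda>m. 0)"
  "f \<oplus>\<^bsub>QSym\<^esub> g = (\<lambda>m. f m + g m)"
  "c \<odot>\<^bsub>QSym\<^esub> f = (\<lambda>m. c * f m)"
  by (simp_all add: QSym_def series_mult_def fun_eq_iff)

lemma series_mult_commute: "series_mult f g = series_mult g f"
proof
  fix m
  show "series_mult f g m = series_mult g f m"
    unfolding series_mult_def
    by (rule sum.reindex_bij_witness[of _ prod.swap prod.swap]) (auto simp: add.commute)
qed

lemma series_mult_assoc: "series_mult (series_mult f g) h = series_mult f (series_mult g h)"
proof
  fix m
  have fin: "finite {(p, q). p + q = n}" for n :: "nat \<Rightarrow>\<^sub>0 nat"
    by (rule finite_monomial_decompositions)
  have "series_mult (series_mult f g) h m =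
      (\<Sum>x | fst x + snd x = m. \<Sum>y | fst y + snd y = fst x. f (fst y) * g (snd y) * h (snd x))"
    by (simp add: series_mult_def sum_distrib_right case_prod_unfold)
  also have "\<dots> = (\<Sum>(x, y)\<in>(SIGMA x:{x. fst x + snd x = m}. {y. fst y + snd y = fst x}).
      f (fst y) * g (snd y) * h (snd x))"
    using fin by (intro sum.Sigma) (simp_all add: case_prod_unfold)
  also have "\<dots> = (\<Sum>(x, y)\<in>(SIGMA x:{x. fst x + snd x = m}. {y. fst y + snd y = snd x}).
      f (fst x) * (g (fst y) * h (snd y)))"
    \<comment> \<open>Both sides run over triples \<open>(a, b, c)\<close> with sum
      \<open>m\<close>, encoded according to the two bracketings.\<close>
    by (rule sum.reindex_bij_witness[of _ "\<lambda>((a, _), (b, c)). ((a + b, c), (a, b))"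
          "\<lambda>((_, c), (a, b)). ((a, b + c), (b, c))"])
      (auto simp: add.assoc mult.assoc)
  also have "\<dots> = (\<Sum>x | fst x + snd x = m. \<Sum>y | fst y + snd y = snd x. f (fst x) * (g (fst y) * h (snd y)))"
    using fin by (intro sum.Sigma[symmetric]) (simp_all add: case_prod_unfold)
  also have "\<dots> = series_mult f (series_mult g h) m"
    by (simp add: series_mult_def sum_distrib_left case_prod_unfold)
  finally show "series_mult (series_mult f g) h m = series_mult f (series_mult g h) m" .
qed

lemma series_mult_one: "series_mult (\<lambda>m. if m = 0 then 1 else 0) f = f"
proof
  fix m
  have "series_mult (\<lambda>m. if m = 0 then 1 else 0) f m =
      (\<Sum>x | fst x + snd x = m. if x = (0, m) then f m else 0)"
    unfolding series_mult_def case_prod_unfold by (intro sum.cong) (auto simp: prod_eq_iff)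
  also have "\<dots> = f m"
    using finite_monomial_decompositions[of m] by (simp add: sum.delta case_prod_unfold)
  finally show "series_mult (\<lambda>m. if m = 0 then 1 else 0) f m = f m" .
qed

lemma series_mult_sum:
  "finite K \<Longrightarrow> series_mult (\<lambda>m. \<Sum>k\<in>K. c k * f k m) g = (\<lambda>m. \<Sum>k\<in>K. c k * series_mult (f k) g m)"
  by (simp add: fun_eq_iff series_mult_def sum_distrib_left sum_distrib_right case_prod_unfold mult.assoc)
    (auto intro: sum.swap)

lemma series_mult_sum_right:
  "finite K \<Longrightarrow> series_mult g (\<lambda>m. \<Sum>k\<in>K. c k * f k m) = (\<lambda>m. \<Sum>k\<in>K. c k * series_mult g (f k) m)"
  by (subst (1 2) series_mult_commute) (rule series_mult_sum)

lemma series_mult_add: "series_mult (\<lambda>m. f m + g m) h = (\<lambda>m. series_mult f h m + series_mult g h m)"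
  by (simp add: fun_eq_iff series_mult_def case_prod_unfold distrib_right sum.distrib)

lemma series_mult_scale: "series_mult (\<lambda>m. c * f m) g = (\<lambda>m. c * series_mult f g m)"
  by (simp add: fun_eq_iff series_mult_def case_prod_unfold sum_distrib_left mult.assoc)

lemma quasisymmetric_add:
  assumes "quasisymmetric f" "quasisymmetric g"
  shows "quasisymmetric (\<lambda>m. f m + g m)"
proof -
  obtain c d where "\<And>m. f m \<noteq> 0 \<Longrightarrow> monomial_degree m \<le> c" "\<And>m. g m \<noteq> 0 \<Longrightarrow> monomial_degree m \<le> d"
    using assms unfolding quasisymmetric_iff by metis
  then have "\<And>m. f m + g m \<noteq> 0 \<Longrightarrow> monomial_degree m \<le> max c d"
    by (metis add_0 add_cancel_right_right le_max_iff_disj)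
  then show ?thesis
    using assms unfolding quasisymmetric_iff by metis
qed

lemma quasisymmetric_scale: "quasisymmetric f \<Longrightarrow> quasisymmetric (\<lambda>m. c * f m)"
  unfolding quasisymmetric_iff by (metis mult_eq_0_iff)

lemma quasisymmetric_zero: "quasisymmetric (\<lambda>m. 0)"
  by (simp add: quasisymmetric_iff)

lemma quasisymmetric_sum:
  "(\<And>k. k \<in> K \<Longrightarrow> quasisymmetric (f k)) \<Longrightarrow> quasisymmetric (\<lambda>m. \<Sum>k\<in>K. f k m)"
proof (induction K rule: infinite_finite_induct)
  case (insert k K)
  then show ?case by (simp add: quasisymmetric_add)
qed (simp_all add: quasisymmetric_zero)

lemma quasisymmetric_one: "quasisymmetric (\<lambda>m. if m = 0 then 1 else 0)"
  unfolding quasisymmetric_iff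
  by (metis exponents_0 exponents_eq_Nil_iff order_refl)

section \<open>Algebra laws and their transport along a bijection\<close>

lemma algebra_rat_fieldI:
  assumes "cring M"
    and "\<And>a x. x \<in> carrier M \<Longrightarrow> a \<odot>\<^bsub>M\<^esub> x \<in> carrier M"
    and "\<And>a b x. x \<in> carrier M \<Longrightarrow> (a + b) \<odot>\<^bsub>M\<^esub> x = (a \<odot>\<^bsub>M\<^esub> x) \<oplus>\<^bsub>M\<^esub> (b \<odot>\<^bsub>M\<^esub> x)"
    and "\<And>a x y. x \<in> carrier M \<Longrightarrow> y \<in> carrier M \<Longrightarrow> a \<odot>\<^bsub>M\<^esub> (x \<oplus>\<^bsub>M\<^esub> y) = (a \<odot>\<^bsub>M\<^esub> x) \<oplus>\<^bsub>M\<^esub> (a \<odot>\<^bsub>M\<^esub> y)"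
    and "\<And>a b x. x \<in> carrier M \<Longrightarrow> (a * b) \<odot>\<^bsub>M\<^esub> x = a \<odot>\<^bsub>M\<^esub> (b \<odot>\<^bsub>M\<^esub> x)"
    and "\<And>x. x \<in> carrier M \<Longrightarrow> 1 \<odot>\<^bsub>M\<^esub> x = x"
    and "\<And>a x y. x \<in> carrier M \<Longrightarrow> y \<in> carrier M \<Longrightarrow> (a \<odot>\<^bsub>M\<^esub> x) \<otimes>\<^bsub>M\<^esub> y = a \<odot>\<^bsub>M\<^esub> (x \<otimes>\<^bsub>M\<^esub> y)"
  shows "algebra rat_field M"
  using assms by (intro algebraI cring_from_type_algebra) (simp_all add: ring_of_type_algebra_def)

text \<open>Closure of \<open>QSym\<close> under multiplication is not proved directly: it follows once the
  multiplicative map from the shuffle algebra is known to be surjective.\<close>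

lemma algebra_QSym:
  assumes "\<And>f g. quasisymmetric f \<Longrightarrow> quasisymmetric g \<Longrightarrow> quasisymmetric (series_mult f g)"
  shows "algebra rat_field QSym"
proof (rule algebra_rat_fieldI)
  have "abelian_group QSym"
  proof (rule abelian_groupI)
    fix f assume "f \<in> carrier QSym"
    then show "\<exists>g\<in>carrier QSym. g \<oplus>\<^bsub>QSym\<^esub> f = \<zero>\<^bsub>QSym\<^esub>"
      using quasisymmetric_scale[of f "- 1"]
      by (intro bexI[of _ "\<lambda>m. - 1 * f m"]) (simp_all add: QSym_simps)
  qed (auto simp: QSym_simps add_ac intro: quasisymmetric_add quasisymmetric_zero)
  moreover have "comm_monoid QSym"
    by (rule comm_monoidI)
      (simp_all add: QSym_simps assms quasisymmetric_one series_mult_one series_mult_assoc,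
        rule series_mult_commute)
  ultimately show "cring QSym"
    by (rule cringI) (simp add: QSym_simps series_mult_add)
qed (auto simp: QSym_simps quasisymmetric_scale algebra_simps series_mult_scale)

text \<open>Injectivity of \<open>h\<close> reduces each equational law in \<open>A\<close> to the
  same law in \<open>B\<close>; the existence of additive inverses comes from surjectivity.\<close>

lemma algebra_transport:
  assumes B: "algebra rat_field B"
    and bij: "bij_betw h (carrier A) (carrier B)"
    and closed: "\<And>x y. x \<in> carrier A \<Longrightarrow> y \<in> carrier A \<Longrightarrow> x \<oplus>\<^bsub>A\<^esub> y \<in> carrier A"
      "\<And>x y. x \<in> carrier A \<Longrightarrow> y \<in> carrier A \<Longrightarrow> x \<otimes>\<^bsub>A\<^esub> y \<in> carrier A"
      "\<zero>\<^bsub>A\<^esub> \<in> carrier A" "\<one>\<^bsub>A\<^esub> \<in> carrier A"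
      "\<And>c x. x \<in> carrier A \<Longrightarrow> c \<odot>\<^bsub>A\<^esub> x \<in> carrier A"
    and hom: "\<And>x y. x \<in> carrier A \<Longrightarrow> y \<in> carrier A \<Longrightarrow> h (x \<oplus>\<^bsub>A\<^esub> y) = h x \<oplus>\<^bsub>B\<^esub> h y"
      "\<And>x y. x \<in> carrier A \<Longrightarrow> y \<in> carrier A \<Longrightarrow> h (x \<otimes>\<^bsub>A\<^esub> y) = h x \<otimes>\<^bsub>B\<^esub> h y"
      "h \<zero>\<^bsub>A\<^esub> = \<zero>\<^bsub>B\<^esub>" "h \<one>\<^bsub>A\<^esub> = \<one>\<^bsub>B\<^esub>"
      "\<And>c x. x \<in> carrier A \<Longrightarrow> h (c \<odot>\<^bsub>A\<^esub> x) = c \<odot>\<^bsub>B\<^esub> h x"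
  shows "isomorphic_algebras rat_field A B"
proof -
  interpret B: algebra rat_field B by fact
  have h: "h x \<in> carrier B" if "x \<in> carrier A" for x
    using bij that by (auto simp: bij_betw_def)
  have eqI: "x = y" if "h x = h y" "x \<in> carrier A" "y \<in> carrier A" for x y
    using bij that by (auto simp: bij_betw_def inj_on_def)
  have rf: "carrier rat_field = UNIV" "\<one>\<^bsub>rat_field\<^esub> = 1"
    "a \<oplus>\<^bsub>rat_field\<^esub> b = a + b" "a \<otimes>\<^bsub>rat_field\<^esub> b = a * b" for a b
    by (simp_all add: ring_of_type_algebra_def)
  note smult = B.smult_l_distr B.smult_r_distr B.smult_assoc1 B.smult_one B.smult_assoc2 B.smult_closed
  have "algebra rat_field A"
  proof (rule algebra_rat_fieldI)
    have "abelian_group A"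
    proof (rule abelian_groupI)
      fix x assume x: "x \<in> carrier A"
      obtain y where y: "y \<in> carrier A" "h y = \<ominus>\<^bsub>B\<^esub> h x"
        using bij B.a_inv_closed[OF h[OF x]] by (metis bij_betw_def imageE)
      have "y \<oplus>\<^bsub>A\<^esub> x = \<zero>\<^bsub>A\<^esub>"
        using x y h[OF x] by (intro eqI) (simp_all add: closed hom B.l_neg)
      then show "\<exists>y\<in>carrier A. y \<oplus>\<^bsub>A\<^esub> x = \<zero>\<^bsub>A\<^esub>"
        using y by blast
    qed (auto intro!: eqI simp: closed hom h B.a_ac)
    moreover have "comm_monoid A"
      by (rule comm_monoidI) (auto intro!: eqI simp: closed hom h B.m_ac)
    ultimately show "cring A"
      by (rule cringI) (auto intro!: eqI simp: closed hom h B.l_distr)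
  qed (auto intro!: eqI simp: closed hom h smult[unfolded rf, simplified])
  moreover have "h \<in> ring_iso A B"
    using bij by (intro ring_iso_memI) (auto simp: hom h bij_betw_def)
  ultimately show ?thesis
    using B hom(5) unfolding isomorphic_algebras_def by blast
qed

section \<open>The isomorphism\<close>

text \<open>The block expansion followed by Hoffman's exponential: the image in \<open>QSym\<close>
  of the class of \<open>\<alpha>\<close>.\<close>

definition word_series :: "nat list \<Rightarrow> power_series" where
  "word_series \<alpha> m = (\<Sum>u\<in>#block_expansion \<alpha>. hoffman_coeff u (exponents m))"

lemma sum_mset_conv_sum_count:
  fixes F :: "'a \<Rightarrow> 'b :: comm_semiring_1"
  assumes "finite U" "set_mset M \<subseteq> U"
  shows "(\<Sum>u\<in>#M. F u) = (\<Sum>u\<in>U. of_nat (count M u) * F u)"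
  using assms(2)
proof (induction M)
  case (add x M)
  have "(\<Sum>u\<in>U. of_nat (count (add_mset x M) u) * F u) =
      (\<Sum>u\<in>U. of_nat (count M u) * F u + (if u = x then F x else 0))"
    by (intro sum.cong) (auto simp: algebra_simps)
  also have "\<dots> = (\<Sum>u\<in>#M. F u) + F x"
    using add assms(1) by (simp add: sum.distrib sum.delta')
  finally show ?case
    by (simp add: add.commute)
qed simp

lemma count_block_expansion_runs:
  assumes "length u \<le> length (runs \<alpha>)"
  shows "count (block_expansion \<alpha>) u = of_bool (u = runs \<alpha>)"
proof -
  obtain M where M: "block_expansion \<alpha> = {#runs \<alpha>#} + M" "\<forall>u\<in>#M. length (runs \<alpha>) < length u"
    using block_expansion_eq_runs by blast
  have "u \<notin># M"
    using M(2) assms by auto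
  then show ?thesis
    by (simp add: M(1) count_eq_zero_iff)
qed

lemma word_series_Nil: "word_series [] = (\<lambda>m. if m = 0 then 1 else 0)"
proof
  fix m
  have "hoffman_coeff [] (exponents m) = (if m = 0 then 1 else 0)"
    using hoffman_coeff_nonzeroD[of "[]" "exponents m"] exponents_pos[of m] by auto
  then show "word_series [] m = (if m = 0 then 1 else 0)"
    by (simp add: word_series_def)
qed

text \<open>Bilinearity reduces the product to shuffles of block sequences, which then reassemble
  into the expansions of the shuffled words.\<close>

lemma word_series_mult:
  assumes "set \<alpha> \<inter> set \<beta> = {}"
  shows "series_mult (word_series \<alpha>) (word_series \<beta>) m = (\<Sum>\<gamma>\<in>#Sh \<alpha> \<beta>. word_series \<gamma> m)"
proof -
  have left: "series_mult (\<lambda>m. \<Sum>u\<in>#M. F u m) g m = (\<Sum>u\<in>#M. series_mult (F u) g m)"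
    for M :: "nat list multiset" and F g m
  proof (induction M)
    case empty
    then show ?case by (simp add: series_mult_def)
  qed (simp add: series_mult_add)
  have right: "series_mult g (\<lambda>m. \<Sum>u\<in>#M. F u m) m = (\<Sum>u\<in>#M. series_mult g (F u) m)"
    for M :: "nat list multiset" and F g m
    by (simp add: series_mult_commute[of g] left)
  have "series_mult (word_series \<alpha>) (word_series \<beta>) m =
    (\<Sum>u\<in>#block_expansion \<alpha>. \<Sum>v\<in>#block_expansion \<beta>.
      series_mult (\<lambda>m. hoffman_coeff u (exponents m)) (\<lambda>m. hoffman_coeff v (exponents m)) m)"
    unfolding word_series_def left right ..
  also have "\<dots> = (\<Sum>u\<in>#block_expansion \<alpha>. \<Sum>v\<in>#block_expansion \<beta>. \<Sum>w\<in>#Sh u v.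
      hoffman_coeff w (exponents m))"
    by (intro arg_cong[of _ _ sum_mset] image_mset_cong sum_hoffman_coeff_exponents_Sh)
      (simp_all add: block_expansion_pos_sum)
  also have "\<dots> = (\<Sum>\<gamma>\<in>#Sh \<alpha> \<beta>. word_series \<gamma> m)"
    unfolding word_series_def using assms by (rule sum_block_expansion_Sh[symmetric])
  finally show ?thesis .
qed

text \<open>Block lengths add up to \<open>length \<alpha>\<close> and merging parts preserves sums,
  so the series is homogeneous, which bounds its degree.\<close>

lemma quasisymmetric_word_series: "quasisymmetric (word_series \<alpha>)"
proof -
  have "word_series \<alpha> m = 0" if "monomial_degree m \<noteq> length \<alpha>" for m
  proof -
    have "hoffman_coeff u (exponents m) = 0" if "u \<in># block_expansion \<alpha>" for u
      using hoffman_coeff_nonzeroD[of u "exponents m"] exponents_pos[of m]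
        block_expansion_pos_sum[OF that] \<open>monomial_degree m \<noteq> length \<alpha>\<close>
      by (auto simp: sum_list_exponents)
    then have "word_series \<alpha> m = (\<Sum>u\<in>#block_expansion \<alpha>. 0)"
      unfolding word_series_def by (intro arg_cong[of _ _ sum_mset] image_mset_cong)
    then show ?thesis
      by simp
  qed
  moreover have "word_series \<alpha> m = word_series \<alpha> m'" if "exponents m = exponents m'" for m m'
    using that by (simp add: word_series_def)
  ultimately show ?thesis
    unfolding quasisymmetric_iff by (metis order_refl)
qed

section \<open>The word series span the quasisymmetric functions\<close>

lemma length_le_sum_list: "0 \<notin> set u \<Longrightarrow> length u \<le> sum_list (u :: nat list)"
  by (induction u) auto

lemma finite_compositions: "finite {e :: nat list. 0 \<notin> set e \<and> sum_list e \<le> n}"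
proof (rule finite_subset)
  show "{e. 0 \<notin> set e \<and> sum_list e \<le> n} \<subseteq> {e. set e \<subseteq> {..n} \<and> length e \<le> n}"
    using length_le_sum_list member_le_sum_list by (auto intro: order_trans)
  show "finite {e. set e \<subseteq> {..n} \<and> length e \<le> n}"
    by (rule finite_lists_length_le) simp
qed

text \<open>The set \<open>S\<close> is an arbitrary linear subspace; it will be the image of the
  isomorphism. Inverting the two triangular changes in turn puts the Hoffman images \<open>H\<close>
  and then the monomial quasisymmetric functions \<open>M\<close> into \<open>S\<close>.\<close>

lemma quasisymmetric_in_span:
  assumes zero: "(\<lambda>m. 0) \<in> S"
    and add: "\<And>f g. f \<in> S \<Longrightarrow> g \<in> S \<Longrightarrow> (\<lambda>m. f m + g m) \<in> S"
    and scale: "\<And>c f. f \<in> S \<Longrightarrow> (\<lambda>m. c * f m) \<in> S"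
    and words: "\<And>\<alpha>. \<alpha> \<in> words \<Longrightarrow> word_series \<alpha> \<in> S"
    and f: "quasisymmetric f"
  shows "f \<in> S"
proof -
  have sum: "(\<lambda>m. \<Sum>k\<in>K. F k m) \<in> S" if "\<And>k. k \<in> K \<Longrightarrow> F k \<in> S"
    for K :: "nat list set" and F
    using that by (induction K rule: infinite_finite_induct) (auto simp: zero add)
  have sum_mset: "(\<lambda>m. \<Sum>k\<in>#K. F k m) \<in> S" if "\<And>k. k \<in># K \<Longrightarrow> F k \<in> S"
    for K :: "nat list multiset" and F
    using that by (induction K) (auto simp: zero add)
  define H where "H = (\<lambda>u m. hoffman_coeff u (exponents m))"
  define M where "M = (\<lambda>e m. of_bool (exponents m = e) :: rat)"
  \<comment> \<open>The other terms of the expansion have more parts but the same sum. The sum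
    bounds the number of parts, so the difference of the two decreases.\<close>
  have H: "H u \<in> S" if "0 \<notin> set u" for u
    using that
  proof (induction "sum_list u - length u" arbitrary: u rule: less_induct)
    case less
    obtain \<alpha> where \<alpha>: "\<alpha> \<in> words" "runs \<alpha> = u"
      using ex_word_runs[OF less.prems] by blast
    obtain V where V: "block_expansion \<alpha> = {#u#} + V" "\<forall>v\<in>#V. length u < length v"
      using block_expansion_eq_runs[of \<alpha>] \<alpha> by auto
    have "H v \<in> S" if "v \<in># V" for v
    proof (rule less.hyps)
      have v: "0 \<notin> set v" "sum_list v = length \<alpha>"
        using block_expansion_pos_sum[of v \<alpha>] that by (auto simp: V(1))
      then show "0 \<notin> set v"
        by simp
      have "length v \<le> sum_list v" "length u < length v" "sum_list u = sum_list v"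
        using v V(2) that \<alpha> length_le_sum_list[of v] sum_list_runs[of \<alpha>] by auto
      then show "sum_list v - length v < sum_list u - length u"
        by linarith
    qed
    then have "(\<lambda>m. word_series \<alpha> m + - 1 * (\<Sum>v\<in>#V. H v m)) \<in> S"
      by (intro add scale sum_mset words \<alpha>)
    then show ?case
      by (simp add: word_series_def V(1) H_def)
  qed
  have M: "M e \<in> S" if "0 \<notin> set e" for e
    using that
  proof (induction "length e" arbitrary: e rule: less_induct)
    case less
    \<comment> \<open>Contains every composition other than \<open>e\<close> that can occur in
      \<open>H e\<close>; those that do occur are shorter than \<open>e\<close>. The bound on the
      sum keeps the set finite.\<close>
    define K where "K = {e'. 0 \<notin> set e' \<and> sum_list e' \<le> sum_list e} - {e}"
    have "finite K"
      unfolding K_def using finite_compositions by blast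
    have "(\<lambda>m. hoffman_coeff e e' * M e' m) \<in> S" if "e' \<in> K" for e'
    proof (cases "hoffman_coeff e e' = 0")
      case False
      then have "length e' < length e"
        using hoffman_coeff_nonzeroD[of e e'] less.prems that by (auto simp: K_def)
      then show ?thesis
        using that by (intro scale less.hyps) (auto simp: K_def)
    qed (simp add: zero)
    then have "(\<lambda>m. H e m + - 1 * (\<Sum>e'\<in>K. hoffman_coeff e e' * M e' m)) \<in> S"
      using less.prems by (intro add H scale[OF sum])
    also have "(\<lambda>m. H e m + - 1 * (\<Sum>e'\<in>K. hoffman_coeff e e' * M e' m)) = M e"
    proof
      fix m
      have "(\<Sum>e'\<in>K. hoffman_coeff e e' * M e' m) =
          (\<Sum>e'\<in>K. if e' = exponents m then hoffman_coeff e e' else 0)"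
        by (intro sum.cong) (auto simp: M_def)
      also have "\<dots> = (if exponents m \<in> K then H e m else 0)"
        using \<open>finite K\<close> by (simp add: sum.delta H_def)
      also have "\<dots> = H e m - M e m"
      proof (cases "exponents m = e")
        case True
        then show ?thesis
          using hoffman_coeff_self[OF less.prems] by (simp add: K_def H_def M_def)
      next
        case False
        have "hoffman_coeff e (exponents m) = 0" if "exponents m \<notin> K"
          using hoffman_coeff_nonzeroD[OF less.prems exponents_pos, of m] exponents_pos[of m] False that
          unfolding K_def by fastforce
        then show ?thesis
          using False by (simp add: H_def M_def)
      qed
      finally show "H e m + - 1 * (\<Sum>e'\<in>K. hoffman_coeff e e' * M e' m) = M e m"
        by simp
    qed
    finally show ?case .
  qed
  obtain d where d: "\<And>m. f m \<noteq> 0 \<Longrightarrow> monomial_degree m \<le> d"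
    using f unfolding quasisymmetric_iff by blast
  define K where "K = {e :: nat list. 0 \<notin> set e \<and> sum_list e \<le> d}"
  have "finite K"
    unfolding K_def by (rule finite_compositions)
  \<comment> \<open>The expansion of \<open>f\<close> in monomial quasisymmetric functions. By
    quasisymmetry any monomial with exponents \<open>e\<close> reveals the coefficient, and the
    degree bound makes the sum finite.\<close>
  have "(\<lambda>m. \<Sum>e\<in>K. f (SOME m. exponents m = e) * M e m) \<in> S"
    by (intro sum scale M) (simp add: K_def)
  also have "(\<lambda>m. \<Sum>e\<in>K. f (SOME m. exponents m = e) * M e m) = f"
  proof
    fix m
    have "f (SOME m'. exponents m' = exponents m) = f m"
      using f someI[of "\<lambda>m'. exponents m' = exponents m" m] unfolding quasisymmetric_iff by blast
    then have "(\<Sum>e\<in>K. f (SOME m. exponents m = e) * M e m) =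
        (\<Sum>e\<in>K. if e = exponents m then f m else 0)"
      by (intro sum.cong) (auto simp: M_def)
    also have "\<dots> = f m"
      using \<open>finite K\<close> d[of m] exponents_pos[of m]
      by (auto simp: sum.delta K_def sum_list_exponents)
    finally show "(\<Sum>e\<in>K. f (SOME m. exponents m = e) * M e m) = f m" .
  qed
  finally show ?thesis .
qed

section \<open>The linear map on the tie set algebra\<close>

definition class_series :: "nat list set \<Rightarrow> power_series" where
  "class_series C = word_series (SOME \<alpha>. \<alpha> \<in> C)"

text \<open>Members of one class share length and ties, hence their block expansion, so the chosen
  representative does not affect the series.\<close>

lemma class_series_word_class:
  assumes "\<alpha> \<in> words"
  shows "class_series (word_class Tie \<alpha>) = word_series \<alpha>"
proof -
  have "\<alpha> \<in> word_class Tie \<alpha>"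
    using assms by (simp add: word_class_def)
  then have "(SOME \<beta>. \<beta> \<in> word_class Tie \<alpha>) \<in> word_class Tie \<alpha>"
    by (rule someI)
  then have "block_expansion (SOME \<beta>. \<beta> \<in> word_class Tie \<alpha>) = block_expansion \<alpha>"
    by (intro block_expansion_Tie_cong) (auto simp: word_class_def)
  then show ?thesis
    by (simp add: class_series_def word_series_def[abs_def])
qed

definition tie_series :: "(nat list set \<Rightarrow>\<^sub>0 rat) \<Rightarrow> power_series" where
  "tie_series f m = (\<Sum>C\<in>Poly_Mapping.keys f. Poly_Mapping.lookup f C * class_series C m)"

lemma tie_series_superset:
  assumes "finite K" "Poly_Mapping.keys f \<subseteq> K"
  shows "tie_series f m = (\<Sum>C\<in>K. Poly_Mapping.lookup f C * class_series C m)"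
  unfolding tie_series_def using assms by (intro sum.mono_neutral_left) (auto simp: in_keys_iff)

lemma tie_series_0 [simp]: "tie_series 0 m = 0"
  by (simp add: tie_series_def)

lemma tie_series_add: "tie_series (f + g) m = tie_series f m + tie_series g m"
proof -
  define K where "K = Poly_Mapping.keys f \<union> Poly_Mapping.keys g"
  have "finite K" "Poly_Mapping.keys f \<subseteq> K" "Poly_Mapping.keys g \<subseteq> K" "Poly_Mapping.keys (f + g) \<subseteq> K"
    using Poly_Mapping.keys_add[of f g] by (auto simp: K_def)
  then show ?thesis
    by (simp add: tie_series_superset lookup_add distrib_right sum.distrib)
qed

lemma lookup_scale [simp]: "Poly_Mapping.lookup (scale c f) C = c * Poly_Mapping.lookup f C"
  by (simp add: scale_def Poly_Mapping.map.rep_eq when_def)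

lemma keys_scale_subset: "Poly_Mapping.keys (scale c f) \<subseteq> Poly_Mapping.keys f"
  by (auto simp: in_keys_iff)

lemma tie_series_scale: "tie_series (scale c f) m = c * tie_series f m"
  by (subst tie_series_superset[OF _ keys_scale_subset])
    (simp_all add: tie_series_def sum_distrib_left mult.assoc)

lemma tie_series_sum: "tie_series (\<Sum>i\<in>I. F i) m = (\<Sum>i\<in>I. tie_series (F i) m)"
  by (induction I rule: infinite_finite_induct) (simp_all add: tie_series_add)

lemma tie_series_sum_mset: "tie_series (\<Sum>i\<in>#I. F i) m = (\<Sum>i\<in>#I. tie_series (F i) m)"
  by (induction I) (simp_all add: tie_series_add)

lemma tie_series_basis_vec: "tie_series (basis_vec C) m = class_series C m"
  by (simp add: tie_series_def basis_vec_def)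

lemma shuffle_algebra_simps:
  "carrier (shuffle_algebra st) = {f. Poly_Mapping.keys f \<subseteq> word_class st ` words}"
  "f \<otimes>\<^bsub>shuffle_algebra st\<^esub> g = (\<Sum>C\<in>Poly_Mapping.keys f. \<Sum>D\<in>Poly_Mapping.keys g.
     scale (Poly_Mapping.lookup f C * Poly_Mapping.lookup g D) (class_product st C D))"
  "\<one>\<^bsub>shuffle_algebra st\<^esub> = basis_vec (word_class st [])"
  "\<zero>\<^bsub>shuffle_algebra st\<^esub> = 0"
  "f \<oplus>\<^bsub>shuffle_algebra st\<^esub> g = f + g"
  "c \<odot>\<^bsub>shuffle_algebra st\<^esub> f = scale c f"
  by (simp_all add: shuffle_algebra_def)

lemma Sh_words: "\<alpha> \<in> words \<Longrightarrow> \<beta> \<in> words \<Longrightarrow> \<gamma> \<in># Sh \<alpha> \<beta> \<Longrightarrow> \<gamma> \<in> words"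
  by (auto simp: words_def set_mset_Sh set_shuffles)

lemma ex_disjoint_representatives:
  assumes "C \<in> word_class Tie ` words" "D \<in> word_class Tie ` words"
  shows "\<exists>\<alpha>\<in>words. \<exists>\<beta>\<in>words. disjoint_words \<alpha> \<beta> \<and> C = word_class Tie \<alpha> \<and> D = word_class Tie \<beta>"
proof -
  obtain \<alpha> \<beta> where \<alpha>: "\<alpha> \<in> words" "C = word_class Tie \<alpha>" and \<beta>: "\<beta> \<in> words" "D = word_class Tie \<beta>"
    using assms by auto
  \<comment> \<open>Translation keeps the ties. No letter of \<open>\<alpha>\<close> exceeds
    \<open>sum_list \<alpha>\<close>, while the shifted letters do because those of
    \<open>\<beta>\<close> are positive.\<close>
  define \<beta>' where "\<beta>' = map (\<lambda>b. b + sum_list \<alpha>) \<beta>"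
  have "Tie \<beta>' = Tie \<beta>"
    by (auto simp: Tie_def \<beta>'_def)
  then have "D = word_class Tie \<beta>'"
    by (simp add: \<beta> word_class_def \<beta>'_def)
  moreover have "\<beta>' \<in> words"
    using \<beta> by (auto simp: words_def \<beta>'_def)
  moreover have "disjoint_words \<alpha> \<beta>'"
  proof -
    have "b + sum_list \<alpha> \<notin> set \<alpha>" if "b \<in> set \<beta>" for b
      using member_le_sum_list[of "b + sum_list \<alpha>" \<alpha>] \<beta>(1) that by (auto simp: words_def)
    then show ?thesis
      by (auto simp: disjoint_words_def \<beta>'_def)
  qed
  ultimately show ?thesis
    using \<alpha> by blast
qed

lemma class_product_Tie:
  assumes "C \<in> word_class Tie ` words" "D \<in> word_class Tie ` words"
  shows "Poly_Mapping.keys (class_product Tie C D) \<subseteq> word_class Tie ` words"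
    and "tie_series (class_product Tie C D) = series_mult (class_series C) (class_series D)"
proof -
  obtain \<alpha> \<beta> where *: "\<alpha> \<in> words" "\<beta> \<in> words" "disjoint_words \<alpha> \<beta>"
    and C: "C = word_class Tie \<alpha>" and D: "D = word_class Tie \<beta>"
    using ex_disjoint_representatives[OF assms] by blast
  have P: "class_product Tie C D = (\<Sum>\<gamma>\<in>#Sh \<alpha> \<beta>. basis_vec (word_class Tie \<gamma>))"
    unfolding C D by (rule class_product_word_class[OF shuffle_compatible_Tie *])
  have "Poly_Mapping.keys (\<Sum>\<gamma>\<in>#M. basis_vec (word_class Tie \<gamma>)) \<subseteq> word_class Tie ` words"
    if "\<And>\<gamma>. \<gamma> \<in># M \<Longrightarrow> \<gamma> \<in> words" for M
    using that
  proof (induction M)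
    case (add \<gamma> M)
    then show ?case
      using Poly_Mapping.keys_add[of "basis_vec (word_class Tie \<gamma>)"
          "\<Sum>\<gamma>\<in>#M. basis_vec (word_class Tie \<gamma>)"]
      by (auto simp: basis_vec_def)
  qed simp
  then show "Poly_Mapping.keys (class_product Tie C D) \<subseteq> word_class Tie ` words"
    unfolding P using Sh_words[OF *(1,2)] by blast
  show "tie_series (class_product Tie C D) = series_mult (class_series C) (class_series D)"
  proof
    fix m
    have "tie_series (class_product Tie C D) m = (\<Sum>\<gamma>\<in>#Sh \<alpha> \<beta>. word_series \<gamma> m)"
      unfolding P tie_series_sum_mset tie_series_basis_vec
      by (intro arg_cong[of _ _ sum_mset] image_mset_cong)
        (simp add: class_series_word_class Sh_words[OF *(1,2)])
    also have "\<dots> = series_mult (class_series C) (class_series D) m"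
      using * unfolding C D by (simp add: class_series_word_class word_series_mult disjoint_words_def)
    finally show "tie_series (class_product Tie C D) m = series_mult (class_series C) (class_series D) m" .
  qed
qed

lemma tie_series_mult:
  assumes "f \<in> carrier (shuffle_algebra Tie)" "g \<in> carrier (shuffle_algebra Tie)"
  shows "tie_series (f \<otimes>\<^bsub>shuffle_algebra Tie\<^esub> g) = series_mult (tie_series f) (tie_series g)"
proof
  fix m
  have series: "tie_series f =
      (\<lambda>m. \<Sum>C\<in>Poly_Mapping.keys f. Poly_Mapping.lookup f C * class_series C m)" for f
    by (simp add: fun_eq_iff tie_series_def)
  have "tie_series (f \<otimes>\<^bsub>shuffle_algebra Tie\<^esub> g) m =
    (\<Sum>C\<in>Poly_Mapping.keys f. \<Sum>D\<in>Poly_Mapping.keys g. Poly_Mapping.lookup f C *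
      Poly_Mapping.lookup g D * series_mult (class_series C) (class_series D) m)"
    unfolding shuffle_algebra_simps tie_series_sum tie_series_scale
    using assms by (intro sum.cong refl) (auto simp: shuffle_algebra_simps class_product_Tie(2) subset_iff)
  also have "\<dots> = (\<Sum>C\<in>Poly_Mapping.keys f. Poly_Mapping.lookup f C *
      series_mult (class_series C) (tie_series g) m)"
    by (simp add: series series_mult_sum_right sum_distrib_left mult.assoc)
  also have "\<dots> = series_mult (tie_series f) (tie_series g) m"
    unfolding series[of f] by (simp add: series_mult_sum)
  finally show "tie_series (f \<otimes>\<^bsub>shuffle_algebra Tie\<^esub> g) m = series_mult (tie_series f) (tie_series g) m" .
qed

lemma shuffle_algebra_Tie_mult_closed:
  assumes "f \<in> carrier (shuffle_algebra Tie)" "g \<in> carrier (shuffle_algebra Tie)"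
  shows "f \<otimes>\<^bsub>shuffle_algebra Tie\<^esub> g \<in> carrier (shuffle_algebra Tie)"
proof -
  have sum: "Poly_Mapping.keys (\<Sum>i\<in>I. F i) \<subseteq> K" if "\<And>i. i \<in> I \<Longrightarrow> Poly_Mapping.keys (F i) \<subseteq> K"
    for I :: "nat list set set" and F :: "_ \<Rightarrow> nat list set \<Rightarrow>\<^sub>0 rat" and K
    using that
  proof (induction I rule: infinite_finite_induct)
    case (insert i I)
    then show ?case
      using Poly_Mapping.keys_add[of "F i" "sum F I"] by auto
  qed simp_all
  show ?thesis
    using assms class_product_Tie(1) unfolding shuffle_algebra_simps mem_Collect_eq
    by (intro sum order_trans[OF keys_scale_subset]) blast
qed

text \<open>The two triangularities are applied one after the other: fewest runs shows that the
  expansion of \<open>f\<close> into compositions is nonzero, and the most parts among the surviving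
  compositions gives a monomial with nonzero coefficient.\<close>

lemma tie_series_eq_0D:
  assumes f: "f \<in> carrier (shuffle_algebra Tie)" and 0: "\<And>m. tie_series f m = 0"
  shows "f = 0"
proof (rule ccontr)
  assume "f \<noteq> 0"
  \<comment> \<open>The same choice as in \<open>class_series\<close>, so that the series of a class
    unfolds to the block expansion of \<open>r C\<close>.\<close>
  define r where "r = (\<lambda>C::nat list set. SOME \<alpha>. \<alpha> \<in> C)"
  have r: "C = word_class Tie (r C)" if C: "C \<in> Poly_Mapping.keys f" for C
  proof -
    obtain \<alpha> where \<alpha>: "\<alpha> \<in> words" "C = word_class Tie \<alpha>"
      using f C unfolding shuffle_algebra_simps by blast
    then have "\<alpha> \<in> C"
      by (simp add: word_class_def)
    then have "r C \<in> C"
      unfolding r_def by (rule someI)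
    then show ?thesis
      by (auto simp: \<alpha> word_class_def)
  qed
  have runs_inj: "C = D"
    if "C \<in> Poly_Mapping.keys f" "D \<in> Poly_Mapping.keys f" "runs (r C) = runs (r D)" for C D
  proof -
    have "word_class Tie (r C) = word_class Tie (r D)"
      using that(3) unfolding runs_eq_iff by (simp add: word_class_def)
    then show ?thesis
      using r that by metis
  qed
  define U where "U = (\<Union>C\<in>Poly_Mapping.keys f. set_mset (block_expansion (r C)))"
  \<comment> \<open>The coefficient of the composition \<open>u\<close> in the block expansion of
    \<open>f\<close>.\<close>
  define g where "g = (\<lambda>u. \<Sum>C\<in>Poly_Mapping.keys f.
    Poly_Mapping.lookup f C * of_nat (count (block_expansion (r C)) u))"
  define V where "V = {u \<in> U. g u \<noteq> 0}"
  have "finite U"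
    by (simp add: U_def)
  have tie_g: "tie_series f m = (\<Sum>u\<in>U. g u * hoffman_coeff u (exponents m))" for m
  proof -
    have "class_series C m =
      (\<Sum>u\<in>U. of_nat (count (block_expansion (r C)) u) * hoffman_coeff u (exponents m))"
      if "C \<in> Poly_Mapping.keys f" for C
    proof -
      have "class_series C m = (\<Sum>u\<in>#block_expansion (r C). hoffman_coeff u (exponents m))"
        by (simp add: class_series_def word_series_def r_def)
      also have "\<dots> = (\<Sum>u\<in>U. of_nat (count (block_expansion (r C)) u) * hoffman_coeff u (exponents m))"
        using \<open>finite U\<close> that by (intro sum_mset_conv_sum_count) (auto simp: U_def)
      finally show ?thesis .
    qed
    then have "tie_series f m = (\<Sum>C\<in>Poly_Mapping.keys f. \<Sum>u\<in>U. Poly_Mapping.lookup f C *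
        of_nat (count (block_expansion (r C)) u) * hoffman_coeff u (exponents m))"
      by (simp add: tie_series_def sum_distrib_left mult.assoc)
    also have "\<dots> = (\<Sum>u\<in>U. g u * hoffman_coeff u (exponents m))"
      unfolding g_def sum_distrib_right by (rule sum.swap)
    finally show ?thesis .
  qed
  text \<open>A class with the fewest runs contributes a composition that no other class can cancel.\<close>
  obtain C where C: "C \<in> Poly_Mapping.keys f"
    and C_min: "\<And>D. D \<in> Poly_Mapping.keys f \<Longrightarrow> length (runs (r C)) \<le> length (runs (r D))"
    using \<open>f \<noteq> 0\<close> ex_has_least_nat[of "\<lambda>C. C \<in> Poly_Mapping.keys f" _ "\<lambda>C. length (runs (r C))"]
    by (metis all_not_in_conv keys_eq_empty)
  have "g (runs (r C)) = (\<Sum>D\<in>Poly_Mapping.keys f. if D = C then Poly_Mapping.lookup f C else 0)"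
    unfolding g_def using C C_min runs_inj by (intro sum.cong) (auto simp: count_block_expansion_runs)
  also have "\<dots> = Poly_Mapping.lookup f C"
    using C by simp
  finally have "g (runs (r C)) \<noteq> 0"
    using C by (simp add: in_keys_iff)
  moreover have g_U: "g u = 0" if "u \<notin> U" for u
    unfolding g_def using that by (intro sum.neutral) (auto simp: U_def count_eq_zero_iff)
  ultimately have "runs (r C) \<in> V"
    by (auto simp: V_def)
  then have V: "finite V" "V \<noteq> {}"
    using \<open>finite U\<close> by (auto simp: V_def)
  \<comment> \<open>A composition \<open>v\<close> contributes to the monomial with exponents
    \<open>u\<close> only if \<open>u\<close> arises from \<open>v\<close> by merging parts;
    maximality of \<open>length u\<close> leaves \<open>v = u\<close> alone.\<close>
  then obtain u where uV: "u \<in> V" "Max (length ` V) = length u"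
    by (rule obtains_MAX)
  then have u: "u \<in> U" "g u \<noteq> 0"
    by (auto simp: V_def)
  have u_max: "length v \<le> length u" if "v \<in> U" "g v \<noteq> 0" for v
    unfolding uV(2)[symmetric] using that V by (intro Max_ge) (auto simp: V_def)
  have pos: "0 \<notin> set v" if "v \<in> U" for v
    using that block_expansion_pos_sum by (auto simp: U_def)
  obtain m where m: "exponents m = u"
    using ex_monomial_exponents[OF pos[OF u(1)]] by blast
  have "tie_series f m = (\<Sum>v\<in>U. if v = u then g u else 0)"
    unfolding tie_g m
  proof (rule sum.cong)
    fix v assume v: "v \<in> U"
    show "g v * hoffman_coeff v u = (if v = u then g u else 0)"
      using hoffman_coeff_nonzeroD[of v u] u_max[OF v] pos[OF v] pos[OF u(1)] hoffman_coeff_self[of u]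
      by (cases "g v = 0") auto
  qed simp
  then show False
    using 0 u \<open>finite U\<close> by simp
qed

lemma tie_series_bij_betw: "bij_betw tie_series (carrier (shuffle_algebra Tie)) (carrier QSym)"
proof -
  let ?A = "carrier (shuffle_algebra Tie)"
  have add: "x + y \<in> ?A" if "x \<in> ?A" "y \<in> ?A" for x y
    using that Poly_Mapping.keys_add[of x y] by (auto simp: shuffle_algebra_simps)
  have scale: "scale c x \<in> ?A" if "x \<in> ?A" for c x
    using that keys_scale_subset[of c x] by (auto simp: shuffle_algebra_simps)
  have "inj_on tie_series ?A"
  proof (rule inj_onI)
    fix x y assume xy: "x \<in> ?A" "y \<in> ?A" "tie_series x = tie_series y"
    have "x + scale (- 1) y = 0"
      using xy by (intro tie_series_eq_0D add scale) (simp_all add: tie_series_add tie_series_scale)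
    moreover have "scale (- 1) y = - y"
      by (rule poly_mapping_eqI) simp
    ultimately show "x = y"
      by simp
  qed
  moreover have "tie_series x \<in> carrier QSym" for x
    unfolding tie_series_def[abs_def] class_series_def
    by (simp add: QSym_simps quasisymmetric_sum quasisymmetric_scale quasisymmetric_word_series)
  \<comment> \<open>The image is a linear subspace containing all word series, hence contains
    everything they span.\<close>
  moreover have "f \<in> tie_series ` ?A" if "quasisymmetric f" for f
    using _ _ _ _ that
  proof (rule quasisymmetric_in_span)
    show "(\<lambda>m. 0) \<in> tie_series ` ?A"
      by (rule image_eqI[of _ _ 0]) (simp_all add: fun_eq_iff shuffle_algebra_simps)
    show "(\<lambda>m. f m + g m) \<in> tie_series ` ?A"
      if fg: "f \<in> tie_series ` ?A" "g \<in> tie_series ` ?A" for f g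
    proof -
      obtain x y where "x \<in> ?A" "f = tie_series x" "y \<in> ?A" "g = tie_series y"
        using fg by blast
      then show ?thesis
        by (intro image_eqI[of _ _ "x + y"]) (simp_all add: fun_eq_iff tie_series_add add)
    qed
    show "(\<lambda>m. c * f m) \<in> tie_series ` ?A" if f: "f \<in> tie_series ` ?A" for c f
    proof -
      obtain x where "x \<in> ?A" "f = tie_series x"
        using f by blast
      then show ?thesis
        by (intro image_eqI[of _ _ "scale c x"]) (simp_all add: fun_eq_iff tie_series_scale scale)
    qed
    show "word_series \<alpha> \<in> tie_series ` ?A" if "\<alpha> \<in> words" for \<alpha>
      using that
      by (intro image_eqI[of _ _ "basis_vec (word_class Tie \<alpha>)"])
        (simp_all add: fun_eq_iff tie_series_basis_vec class_series_word_class,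
         simp add: shuffle_algebra_simps basis_vec_def)
  qed
  ultimately show ?thesis
    by (auto simp: bij_betw_def QSym_simps)
qed

theorem theorem3p14:
  shows "shuffle_compatible Tie \<and>
         isomorphic_algebras rat_field (shuffle_algebra Tie) QSym"
proof
  show "shuffle_compatible Tie"
    by (rule shuffle_compatible_Tie)
  have "quasisymmetric (series_mult f g)" if fg: "quasisymmetric f" "quasisymmetric g" for f g
  proof -
    have "f \<in> tie_series ` carrier (shuffle_algebra Tie)" "g \<in> tie_series ` carrier (shuffle_algebra Tie)"
      using fg by (simp_all add: bij_betw_imp_surj_on[OF tie_series_bij_betw] QSym_simps(1))
    then obtain x y where "x \<in> carrier (shuffle_algebra Tie)" "f = tie_series x"
      "y \<in> carrier (shuffle_algebra Tie)" "g = tie_series y"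
      by blast
    then show ?thesis
      using bij_betw_apply[OF tie_series_bij_betw shuffle_algebra_Tie_mult_closed, of x y]
      by (simp only: tie_series_mult QSym_simps(1) mem_Collect_eq)
  qed
  then have "algebra rat_field QSym"
    by (rule algebra_QSym)
  then show "isomorphic_algebras rat_field (shuffle_algebra Tie) QSym"
  proof (rule algebra_transport[OF _ tie_series_bij_betw])
    have "[] \<in> words"
      by (simp add: words_def)
    then show "\<one>\<^bsub>shuffle_algebra Tie\<^esub> \<in> carrier (shuffle_algebra Tie)"
      "tie_series \<one>\<^bsub>shuffle_algebra Tie\<^esub> = \<one>\<^bsub>QSym\<^esub>"
      by (auto simp: shuffle_algebra_simps basis_vec_def QSym_simps fun_eq_iff
          tie_series_basis_vec[unfolded basis_vec_def] class_series_word_class word_series_Nil)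
    fix x y assume x: "x \<in> carrier (shuffle_algebra Tie)"
    show "c \<odot>\<^bsub>shuffle_algebra Tie\<^esub> x \<in> carrier (shuffle_algebra Tie)" for c
      using x keys_scale_subset[of c x] by (auto simp: shuffle_algebra_simps)
    assume y: "y \<in> carrier (shuffle_algebra Tie)"
    show "x \<oplus>\<^bsub>shuffle_algebra Tie\<^esub> y \<in> carrier (shuffle_algebra Tie)"
      using x y Poly_Mapping.keys_add[of x y] by (auto simp: shuffle_algebra_simps)
  qed (simp_all add: shuffle_algebra_Tie_mult_closed tie_series_mult, simp_all add: shuffle_algebra_simps QSym_simps
      fun_eq_iff tie_series_add tie_series_scale)
qed

end
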